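(* Let $E\subset\mathbb{R}^2$ be a closed, nondegenerate, convex quadrilateral, let $r\ge 2$, and let $\mathcal{DS}_r(E)$ be the span of the vertex, edge and cell shape functions defined in the context, for any admissible choice of $\lambda_H,\lambda_V,R_V,R_H$. Let $\mathbf{x}_{n,1},\dots,\mathbf{x}_{n,D_r}$, with $D_r=\tfrac12(r+2)(r+1)+2$, be the nodal points defined in the context, and let $N_k(\phi)=\phi(\mathbf{x}_{n,k})$. If $\phi\in\mathcal{DS}_r(E)$ and $N_k(\phi)=0$ for all $k=1,2,\dots,D_r$, then $\phi=0$. Moreover, $$\mathcal{DS}_r(E)=\mathbb{P}_r(E)\oplus\mathbb{S}_r^{\mathcal{DS}}(E),\qquad \mathbb{S}_r^{\mathcal{DS}}(E)=\mathrm{span}\{\lambda_3\lambda_4\lambda_H^{r-2}R_V,\ \lambda_1\lambda_2\lambda_V^{r-2}R_H\}.$$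
   Context: $\mathbb{P}_k(E)$ is the space of (restrictions to $E$ of) real polynomials in two variables of total degree at most $k$ ($\{0\}$ if $k<0$). Quadrilateral. $E$ is nondegenerate if it does not degenerate to a triangle, segment or point. Its edges are numbered so that $e_1,e_2$ is one pair of opposite edges and $e_3,e_4$ is the other pair. $\nu_i$ is the unit outer normal to $e_i$, and $\lambda_i(\mathbf{x})=-(\mathbf{x}-\mathbf{x}_i)\cdot\nu_i$ for any $\mathbf{x}_i\in e_i$, so that $\lambda_i$ is linear, vanishes on $e_i$, and is positive in the interior of $E$. $\mathcal{L}_i$ is the infinite line containing $e_i$. Admissible choices. - $\lambda_H$ is a linear polynomial. If $e_1\parallel e_2$, the only requirement is that the zero line of $\lambda_H$ intersects both $\mathcal{L}_1$ and $\mathcal{L}_2$. If $e_1\nparallel e_2$, then $\lambda_H=\alpha_H\lambda_1+\beta_H\lambda_2+\gamma_H$ with $\alpha_H>0$, $\beta_H>0$, $\gamma_H\neq0$. - $\lambda_V$ is a linear polynomial. If $e_3\parallel e_4$, the only requirement is that the zero line of $\lambda_V$ intersects both $\mathcal{L}_3$ and $\mathcal{L}_4$. If $e_3\nparallel e_4$, then $\lambda_V=\alpha_V\lambda_3+\beta_V\lambda_4+\gamma_V$ with $\alpha_V>0$, $\beta_V>0$, $\gamma_V\neq0$. - $R_V,R_H$ are bounded real functions on $E$ such that, for some positive constants $\eta_V,\xi_V,\eta_H,\xi_H$: $R_V=-\eta_V$ on $e_1$, $R_V=\xi_V$ on $e_2$, $R_H=-\eta_H$ on $e_3$, $R_H=\xi_H$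 on $e_4$. Auxiliary linear functions. $\lambda_{12}=\alpha_H\xi_V\lambda_1-\beta_H\eta_V\lambda_2$ if $e_1\nparallel e_2$, and $\lambda_{12}=\xi_V\lambda_1-\eta_V\lambda_2$ if $e_1\parallel e_2$. $\lambda_{34}=\alpha_V\xi_H\lambda_3-\beta_V\eta_H\lambda_4$ if $e_3\nparallel e_4$, and $\lambda_{34}=\xi_H\lambda_3-\eta_H\lambda_4$ if $e_3\parallel e_4$. Shape functions. $\mathcal{DS}_r(E)$ is the span of: - vertex functions: $\lambda_2\lambda_4,\ \lambda_2\lambda_3,\ \lambda_1\lambda_4,\ \lambda_1\lambda_3$; - edge functions for $e_1,e_2$: $\lambda_3\lambda_4\lambda_H^j$ ($0\le j\le r-2$), $\lambda_3\lambda_4\lambda_{12}\lambda_H^j$ ($0\le j\le r-3$), and $\lambda_3\lambda_4R_V\lambda_H^{r-2}$; - edge functions for $e_3,e_4$: $\lambda_1\lambda_2\lambda_V^j$ ($0\le j\le r-2$), $\lambda_1\lambda_2\lambda_{34}\lambda_V^j$ ($0\le j\le r-3$), and $\lambda_1\lambda_2R_H\lambda_V^{r-2}$; - cell functions: a basis of $\lambda_1\lambda_2\lambda_3\lambda_4\,\mathbb{P}_{r-4}$ (none if $r<4$). Nodal points. The $D_r=4+4(r-1)+\tfrac12(r-2)(r-3)$ nodal points are: the 4 vertices of $E$; on each edge, $r-1$ interior points which together with the two end vertices are equally spaced; and, if $r\ge4$, $\tfrac12(r-2)(r-3)$ interior points, namely the nodes of the Lagrange finite element of order $r-4$ on a (nondegenerate)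 triangle $T$ lying strictly inside $E$ (a single point if $r=4$). *)

theory Defs
  imports "HOL-Analysis.Analysis" "HOL-Library.Function_Algebras"
begin

text \<open>
  Real functions on the plane form a vector space under the pointwise operations. Addition and
  zero come from the library; there is no \<open>real_vector\<close> instance for function types, so
  the scalar action is given explicitly.
\<close>

global_interpretation fun_space:
  vector_space "\<lambda>(c::real) (f :: real ^ 2 \<Rightarrow> real) x. c * f x"
  defines fun_span = fun_space.span
    and fun_subspace = fun_space.subspace
  by unfold_locales (auto simp: fun_eq_iff algebra_simps)

definition direct_sum_of ::
  "(real ^ 2 \<Rightarrow> real) set \<Rightarrow> (real ^ 2 \<Rightarrow> real) set \<Rightarrow> (real ^ 2 \<Rightarrow> real) set \<Rightarrow> bool" where
  "direct_sum_of W U V \<longleftrightarrow>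
     fun_subspace U \<and> fun_subspace V \<and> W = {u + v | u v. u \<in> U \<and> v \<in> V} \<and> U \<inter> V = {0}"

text \<open>
  A function on \<open>E\<close> is represented by its extension by zero to the whole plane, so
  equality of represented functions is equality on \<open>E\<close>.
\<close>

definition restrict_fun :: "(real ^ 2) set \<Rightarrow> (real ^ 2 \<Rightarrow> real) \<Rightarrow> real ^ 2 \<Rightarrow> real" where
  "restrict_fun E f = (\<lambda>x. if x \<in> E then f x else 0)"

text \<open>
  The degree is an integer, so that the space is \<open>{0}\<close> for negative degree.
\<close>

definition polys :: "int \<Rightarrow> (real ^ 2 \<Rightarrow> real) set" where
  "polys k = fun_span {\<lambda>x. (x $ 1) ^ i * (x $ 2) ^ j | i j :: nat. int (i + j) \<le> k}"

definition polys_on :: "(real ^ 2) set \<Rightarrow> int \<Rightarrow> (real ^ 2 \<Rightarrow> real) set" where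
  "polys_on E k = restrict_fun E ` polys k"


text \<open>
  Having four extreme points makes the quadrilateral nondegenerate. The vertex \<open>vij\<close> is
  the one shared by \<open>ei\<close> and \<open>ej\<close>.
\<close>

definition convex_quadrilateral ::
  "(real ^ 2) set \<Rightarrow> (real ^ 2) set \<Rightarrow> (real ^ 2) set \<Rightarrow> (real ^ 2) set \<Rightarrow> (real ^ 2) set \<Rightarrow> bool" where
  "convex_quadrilateral E e1 e2 e3 e4 \<longleftrightarrow>
     (\<exists>v13 v14 v23 v24.
        card {v13, v14, v23, v24} = 4 \<and>
        E = convex hull {v13, v14, v23, v24} \<and>
        {v. v extreme_point_of E} = {v13, v14, v23, v24} \<and>
        e1 = closed_segment v13 v14 \<and> e2 = closed_segment v23 v24 \<and>
        e3 = closed_segment v13 v23 \<and> e4 = closed_segment v14 v24 \<and>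
        e1 edge_of E \<and> e2 edge_of E \<and> e3 edge_of E \<and> e4 edge_of E)"

definition unit_outer_normal :: "(real ^ 2) set \<Rightarrow> (real ^ 2) set \<Rightarrow> real ^ 2 \<Rightarrow> bool" where
  "unit_outer_normal E e \<nu> \<longleftrightarrow>
     norm \<nu> = 1 \<and> (\<forall>x\<in>e. \<forall>y\<in>e. (x - y) \<bullet> \<nu> = 0) \<and> (\<forall>x\<in>e. \<forall>y\<in>E. (y - x) \<bullet> \<nu> \<le> 0)"

definition edge_linear :: "(real ^ 2) set \<Rightarrow> (real ^ 2) set \<Rightarrow> (real ^ 2 \<Rightarrow> real) \<Rightarrow> bool" where
  "edge_linear E e l \<longleftrightarrow>
     (\<exists>\<nu> x0. unit_outer_normal E e \<nu> \<and> x0 \<in> e \<and> l = (\<lambda>x. - ((x - x0) \<bullet> \<nu>)))"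

definition parallel_edges :: "(real ^ 2) set \<Rightarrow> (real ^ 2) set \<Rightarrow> bool" where
  "parallel_edges e e' \<longleftrightarrow> affine_parallel (affine hull e) (affine hull e')"

text \<open>
  Degree exactly one, so that the zero set is a line.
\<close>

definition linear_poly :: "(real ^ 2 \<Rightarrow> real) \<Rightarrow> bool" where
  "linear_poly l \<longleftrightarrow> (\<exists>a b. a \<noteq> 0 \<and> l = (\<lambda>x. a \<bullet> x + b))"

text \<open>
  In the parallel case the coefficients \<open>\<alpha>\<close>, \<open>\<beta>\<close>,
  \<open>\<gamma>\<close> play no role, here and in \<open>aux_linear\<close>.
\<close>

definition admissible_linear ::
  "(real ^ 2) set \<Rightarrow> (real ^ 2) set \<Rightarrow> (real ^ 2 \<Rightarrow> real) \<Rightarrow> (real ^ 2 \<Rightarrow> real) \<Rightarrow>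
   real \<Rightarrow> real \<Rightarrow> real \<Rightarrow> (real ^ 2 \<Rightarrow> real) \<Rightarrow> bool" where
  "admissible_linear e e' l l' \<alpha> \<beta> \<gamma> lH \<longleftrightarrow>
     linear_poly lH \<and>
     (if parallel_edges e e'
      then {x. lH x = 0} \<inter> affine hull e \<noteq> {} \<and> {x. lH x = 0} \<inter> affine hull e' \<noteq> {}
      else \<alpha> > 0 \<and> \<beta> > 0 \<and> \<gamma> \<noteq> 0 \<and> lH = (\<lambda>x. \<alpha> * l x + \<beta> * l' x + \<gamma>))"

text \<open>
  Only the values of \<open>R\<close> on \<open>E\<close> matter.
\<close>

definition admissible_supplement ::
  "(real ^ 2) set \<Rightarrow> (real ^ 2) set \<Rightarrow> (real ^ 2) set \<Rightarrow> real \<Rightarrow> real \<Rightarrow> (real ^ 2 \<Rightarrow> real) \<Rightarrow> bool" where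
  "admissible_supplement E e e' \<eta> \<xi> R \<longleftrightarrow>
     bounded (R ` E) \<and> \<eta> > 0 \<and> \<xi> > 0 \<and> (\<forall>x\<in>e. R x = - \<eta>) \<and> (\<forall>x\<in>e'. R x = \<xi>)"

definition aux_linear ::
  "(real ^ 2) set \<Rightarrow> (real ^ 2) set \<Rightarrow> (real ^ 2 \<Rightarrow> real) \<Rightarrow> (real ^ 2 \<Rightarrow> real) \<Rightarrow>
   real \<Rightarrow> real \<Rightarrow> real \<Rightarrow> real \<Rightarrow> real ^ 2 \<Rightarrow> real" where
  "aux_linear e e' l l' \<alpha> \<beta> \<eta> \<xi> =
     (if parallel_edges e e' then (\<lambda>x. \<xi> * l x - \<eta> * l' x)
      else (\<lambda>x. \<alpha> * \<xi> * l x - \<beta> * \<eta> * l' x))"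


definition vertex_funs ::
  "(real ^ 2 \<Rightarrow> real) \<Rightarrow> (real ^ 2 \<Rightarrow> real) \<Rightarrow> (real ^ 2 \<Rightarrow> real) \<Rightarrow> (real ^ 2 \<Rightarrow> real) \<Rightarrow>
   (real ^ 2 \<Rightarrow> real) set" where
  "vertex_funs l1 l2 l3 l4 =
     {\<lambda>x. l2 x * l4 x, \<lambda>x. l2 x * l3 x, \<lambda>x. l1 x * l4 x, \<lambda>x. l1 x * l3 x}"

text \<open>
  The edge functions for one pair of opposite edges; \<open>la\<close>, \<open>lb\<close> belong to the
  other pair. The side conditions are \<open>j \<le> r - 2\<close> and \<open>j \<le> r - 3\<close>
  without truncated subtraction.
\<close>

definition edge_funs ::
  "nat \<Rightarrow> (real ^ 2 \<Rightarrow> real) \<Rightarrow> (real ^ 2 \<Rightarrow> real) \<Rightarrow> (real ^ 2 \<Rightarrow> real) \<Rightarrow> (real ^ 2 \<Rightarrow> real) \<Rightarrow>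
   (real ^ 2 \<Rightarrow> real) \<Rightarrow> (real ^ 2 \<Rightarrow> real) set" where
  "edge_funs r la lb lH laux R =
     {\<lambda>x. la x * lb x * lH x ^ j | j. j + 2 \<le> r} \<union>
     {\<lambda>x. la x * lb x * laux x * lH x ^ j | j. j + 3 \<le> r} \<union>
     {\<lambda>x. la x * lb x * R x * lH x ^ (r - 2)}"

text \<open>
  All multiples are taken instead of those by a basis of the polynomial space, which does not
  affect the span.
\<close>

definition cell_funs ::
  "nat \<Rightarrow> (real ^ 2 \<Rightarrow> real) \<Rightarrow> (real ^ 2 \<Rightarrow> real) \<Rightarrow> (real ^ 2 \<Rightarrow> real) \<Rightarrow> (real ^ 2 \<Rightarrow> real) \<Rightarrow>
   (real ^ 2 \<Rightarrow> real) set" where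
  "cell_funs r l1 l2 l3 l4 = {\<lambda>x. l1 x * l2 x * l3 x * l4 x * p x | p. p \<in> polys (int r - 4)}"

definition DS ::
  "(real ^ 2) set \<Rightarrow> nat \<Rightarrow> (real ^ 2 \<Rightarrow> real) \<Rightarrow> (real ^ 2 \<Rightarrow> real) \<Rightarrow> (real ^ 2 \<Rightarrow> real) \<Rightarrow>
   (real ^ 2 \<Rightarrow> real) \<Rightarrow> (real ^ 2 \<Rightarrow> real) \<Rightarrow> (real ^ 2 \<Rightarrow> real) \<Rightarrow> (real ^ 2 \<Rightarrow> real) \<Rightarrow>
   (real ^ 2 \<Rightarrow> real) \<Rightarrow> (real ^ 2 \<Rightarrow> real) \<Rightarrow> (real ^ 2 \<Rightarrow> real) \<Rightarrow> (real ^ 2 \<Rightarrow> real) set" where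
  "DS E r l1 l2 l3 l4 lH lV l12 l34 RV RH =
     fun_span (restrict_fun E `
       (vertex_funs l1 l2 l3 l4 \<union> edge_funs r l3 l4 lH l12 RV \<union> edge_funs r l1 l2 lV l34 RH \<union>
        cell_funs r l1 l2 l3 l4))"

definition supplement_space ::
  "(real ^ 2) set \<Rightarrow> nat \<Rightarrow> (real ^ 2 \<Rightarrow> real) \<Rightarrow> (real ^ 2 \<Rightarrow> real) \<Rightarrow> (real ^ 2 \<Rightarrow> real) \<Rightarrow>
   (real ^ 2 \<Rightarrow> real) \<Rightarrow> (real ^ 2 \<Rightarrow> real) \<Rightarrow> (real ^ 2 \<Rightarrow> real) \<Rightarrow> (real ^ 2 \<Rightarrow> real) \<Rightarrow>
   (real ^ 2 \<Rightarrow> real) \<Rightarrow> (real ^ 2 \<Rightarrow> real) set" where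
  "supplement_space E r l1 l2 l3 l4 lH lV RV RH =
     fun_span {restrict_fun E (\<lambda>x. l3 x * l4 x * lH x ^ (r - 2) * RV x),
               restrict_fun E (\<lambda>x. l1 x * l2 x * lV x ^ (r - 2) * RH x)}"


definition edge_nodes :: "nat \<Rightarrow> (real ^ 2) set \<Rightarrow> (real ^ 2) set" where
  "edge_nodes r e =
     {(1 - real j / real r) *\<^sub>R a + (real j / real r) *\<^sub>R b | a b j.
        e = closed_segment a b \<and> 0 < j \<and> j < r}"

text \<open>
  For order zero the Lagrange element has a single node, which may be any point of the triangle.
\<close>

definition lagrange_nodes :: "nat \<Rightarrow> (real ^ 2) set \<Rightarrow> (real ^ 2) set \<Rightarrow> bool" where
  "lagrange_nodes k T N \<longleftrightarrow>
     (\<exists>a b c. \<not> collinear {a, b, c} \<and> T = convex hull {a, b, c} \<and>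
        (if k = 0 then \<exists>p\<in>T. N = {p}
         else N = {(real i / real k) *\<^sub>R a + (real j / real k) *\<^sub>R b + (real m / real k) *\<^sub>R c
                   | i j m. i + j + m = k}))"

definition interior_nodes :: "(real ^ 2) set \<Rightarrow> nat \<Rightarrow> (real ^ 2) set \<Rightarrow> bool" where
  "interior_nodes E r N \<longleftrightarrow>
     (if r < 4 then N = {} else \<exists>T. T \<subseteq> interior E \<and> lagrange_nodes (r - 4) T N)"

definition nodal_points ::
  "(real ^ 2) set \<Rightarrow> (real ^ 2) set \<Rightarrow> (real ^ 2) set \<Rightarrow> (real ^ 2) set \<Rightarrow> (real ^ 2) set \<Rightarrow> nat \<Rightarrow>
   (real ^ 2) set \<Rightarrow> bool" where
  "nodal_points E e1 e2 e3 e4 r X \<longleftrightarrow>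
     (\<exists>N. interior_nodes E r N \<and>
        X = {v. v extreme_point_of E} \<union> (\<Union>e\<in>{e1, e2, e3, e4}. edge_nodes r e) \<union> N)"

end

theory Submission
  imports Defs
begin

text \<open>
  Both halves of the theorem reduce to algebra with the four affine functions of the edges; no
  dimension is ever counted.

  The central observation concerns one pair of opposite edges with affine functions \<open>u\<close> and
  \<open>w\<close>, the admissible function \<open>t\<close> (\<open>\<lambda>\<^sub>H\<close> or \<open>\<lambda>\<^sub>V\<close>) and the auxiliary
  function \<open>z\<close> (\<open>\<lambda>\<^sub>1\<^sub>2\<close> or \<open>\<lambda>\<^sub>3\<^sub>4\<close>). Parallel or not, the pair has weights
  \<open>a\<close>, \<open>b\<close> and numbers \<open>c\<close>, \<open>e\<close> with \<open>e \<noteq> 0\<close> such that \<open>a u + b w = c t + e\<close> and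
  \<open>z = \<xi> a u - \<eta> b w\<close>, and \<open>t\<close>, \<open>z\<close> are affine coordinates of the plane. Write \<open>s = c t + e\<close>.
  Then \<open>z = - \<eta> s\<close> on the first line and \<open>z = \<xi> s\<close> on the second one: up to the factor
  \<open>s\<close>, the polynomial \<open>z\<close> takes the same boundary values as the function \<open>R\<close>, and
  \<open>(z + \<eta> s) (z - \<xi> s)\<close> is a multiple of \<open>u w\<close>. Two consequences carry the proof.

  \<^item> Modulo \<open>u w\<close> the square of \<open>z\<close> can be replaced by terms of degree at most one in
  \<open>z\<close>. Hence every polynomial of degree at most \<open>k\<close> is \<open>C(t) + z D(t)\<close> plus a
  multiple of \<open>u w\<close>, with \<open>deg C \<le> k\<close> and \<open>deg D \<le> k - 1\<close>
  (\<open>polys_split_along_edge_pair\<close>). These are exactly the polynomial edge functions.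

  \<^item> If \<open>C(t) + z D(t) + \<sigma> R t\<^bsup>r-2\<^esup>\<close> vanishes at the inner nodes of both edges, then
  \<open>C - \<eta> G\<close> and \<open>C + \<xi> G\<close> have too many zeros, where
  \<open>G = (c t + e) D + \<sigma> t\<^bsup>r-2\<^esup>\<close>. So \<open>C = G = 0\<close>, and \<open>e \<noteq> 0\<close> forces
  \<open>\<sigma> = 0\<close> and \<open>D = 0\<close> (\<open>edge_coefficients_zero\<close>).

  For unisolvence, the vertices remove the vertex functions, the second consequence for both
  pairs removes the edge functions together with the two supplements, and what remains is
  \<open>\<lambda>\<^sub>1 \<lambda>\<^sub>2 \<lambda>\<^sub>3 \<lambda>\<^sub>4 p\<close> with \<open>p\<close> vanishing at the nodes of a triangle, so that \<open>p = 0\<close>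
  (\<open>polys_zero_on_lagrange_nodes\<close>).

  For the decomposition, every polynomial of degree at most \<open>r\<close> is a combination of vertex
  functions, a multiple of \<open>\<lambda>\<^sub>1 \<lambda>\<^sub>2\<close> and a multiple of \<open>\<lambda>\<^sub>3 \<lambda>\<^sub>4\<close>, the cofactors having degree
  at most \<open>r - 2\<close> (\<open>polys_split_along_quadrilateral\<close>). Splitting the cofactors along
  the other pair shows that the shape functions other than the supplements span all polynomials of degree at
  most \<open>r\<close>. The sum with the supplements is direct since unisolvence kills each supplement
  coefficient separately.
\<close>

section \<open>Polynomials in two variables\<close>

lemma monomial_in_polys: "int (i + j) \<le> k \<Longrightarrow> (\<lambda>x. (x $ 1) ^ i * (x $ 2) ^ j) \<in> polys k"
  unfolding polys_def by (rule fun_space.span_base) auto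

lemma subspace_polys: "fun_subspace (polys k)"
  unfolding polys_def by (rule fun_space.subspace_span)

lemma polys_add: "f \<in> polys k \<Longrightarrow> g \<in> polys k \<Longrightarrow> (\<lambda>x. f x + g x) \<in> polys k"
  using fun_space.subspace_add[OF subspace_polys] by (auto simp: plus_fun_def)

lemma polys_scale: "f \<in> polys k \<Longrightarrow> (\<lambda>x. c * f x) \<in> polys k"
  using fun_space.subspace_scale[OF subspace_polys] by auto

lemma polys_zero: "(\<lambda>x. 0) \<in> polys k"
  using fun_space.subspace_0[OF subspace_polys] by (auto simp: zero_fun_def)

lemma polys_mono: "k \<le> m \<Longrightarrow> polys k \<subseteq> polys m"
  unfolding polys_def by (rule fun_space.span_mono) force

lemma polys_const: "0 \<le> k \<Longrightarrow> (\<lambda>x. c) \<in> polys k"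
  using polys_scale[OF monomial_in_polys[of 0 0 k], of c] by simp

lemma polys_neg: "k < 0 \<Longrightarrow> f \<in> polys k \<Longrightarrow> f = (\<lambda>x. 0)"
proof -
  assume k: "k < 0" and f: "f \<in> polys k"
  have "{\<lambda>x. (x $ 1) ^ i * (x $ 2) ^ j | i j :: nat. int (i + j) \<le> k} = {}" using k by auto
  then show ?thesis using f by (simp add: polys_def zero_fun_def)
qed

lemma polys_subset_subspace:
  assumes "fun_subspace S"
    and "\<And>i j. int (i + j) \<le> k \<Longrightarrow> (\<lambda>x. (x $ 1) ^ i * (x $ 2) ^ j) \<in> S"
  shows "polys k \<subseteq> S"
  unfolding polys_def by (rule fun_space.span_minimal) (use assms in auto)

lemma fun_subspaceI:
  assumes "(\<lambda>x. 0) \<in> S" "\<And>f g. f \<in> S \<Longrightarrow> g \<in> S \<Longrightarrow> (\<lambda>x. f x + g x) \<in> S"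
    "\<And>c f. f \<in> S \<Longrightarrow> (\<lambda>x. c * f x) \<in> S"
  shows "fun_subspace S"
  unfolding fun_space.subspace_def using assms by (auto simp: plus_fun_def zero_fun_def)

lemma polys_mult:
  assumes f: "f \<in> polys m" and g: "g \<in> polys n"
  shows "(\<lambda>x. f x * g x) \<in> polys (m + n)"
proof -
  let ?S = "{f. \<forall>g \<in> polys n. (\<lambda>x. f x * g x) \<in> polys (m + n)}"
  have "polys m \<subseteq> ?S"
  proof (rule polys_subset_subspace)
    show "fun_subspace ?S"
      by (rule fun_subspaceI)
        (auto simp: polys_zero distrib_right mult.assoc intro: polys_add polys_scale)
  next
    fix i j :: nat assume ij: "int (i + j) \<le> m"
    let ?f = "\<lambda>x::real^2. (x $ 1) ^ i * (x $ 2) ^ j"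
    have "polys n \<subseteq> {g. (\<lambda>x. ?f x * g x) \<in> polys (m + n)}"
    proof (rule polys_subset_subspace)
      show "fun_subspace {g. (\<lambda>x. ?f x * g x) \<in> polys (m + n)}"
        by (rule fun_subspaceI)
          (auto simp: polys_zero distrib_left mult.left_commute[of _ "c::real" for c]
             intro: polys_add dest: polys_scale)
    next
      fix i' j' :: nat assume "int (i' + j') \<le> n"
      then have "(\<lambda>x. (x $ 1) ^ (i + i') * (x $ 2) ^ (j + j')) \<in> polys (m + n)"
        using ij by (intro monomial_in_polys) auto
      then show "(\<lambda>x. (x $ 1) ^ i' * (x $ 2) ^ j') \<in> {g. (\<lambda>x. ?f x * g x) \<in> polys (m + n)}"
        by (simp add: power_add mult_ac)
    qed
    then show "?f \<in> ?S" by auto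
  qed
  then show ?thesis using f g by blast
qed

lemma coordinate_in_polys: "(\<lambda>x. x $ 1) \<in> polys 1" "(\<lambda>x. x $ 2) \<in> polys 1"
  using monomial_in_polys[of 1 0 1] monomial_in_polys[of 0 1 1] by auto

text \<open>
  Induction on the degree: a subspace contains all polynomials of degree at most \<open>k + 1\<close> once it
  contains the products of affine functions with polynomials of degree at most \<open>k\<close>.
\<close>
lemma polys_step:
  assumes S: "fun_subspace S"
    and *: "\<And>f g. f \<in> polys 1 \<Longrightarrow> g \<in> polys (int k) \<Longrightarrow> (\<lambda>x. f x * g x) \<in> S"
  shows "polys (int (Suc k)) \<subseteq> S"
proof (rule polys_subset_subspace[OF S])
  fix i j assume ij: "int (i + j) \<le> int (Suc k)"
  consider "i + j \<le> k" | i' where "i = Suc i'" "i' + j \<le> k" | j' where "j = Suc j'" "i + j' \<le> k"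
    using ij by (cases i; cases j) auto
  then show "(\<lambda>x. (x $ 1) ^ i * (x $ 2) ^ j) \<in> S"
  proof cases
    case 1
    then have "(\<lambda>x. 1 * ((x $ 1) ^ i * (x $ 2) ^ j)) \<in> S"
      by (intro * polys_const monomial_in_polys) auto
    then show ?thesis by simp
  next
    case 2
    then have "(\<lambda>x. x $ 1 * ((x $ 1) ^ i' * (x $ 2) ^ j)) \<in> S"
      by (intro * coordinate_in_polys monomial_in_polys) auto
    then show ?thesis using 2 by (simp add: mult_ac)
  next
    case 3
    then have "(\<lambda>x. x $ 2 * ((x $ 1) ^ i * (x $ 2) ^ j')) \<in> S"
      by (intro * coordinate_in_polys monomial_in_polys) auto
    then show ?thesis using 3 by (simp add: mult_ac)
  qed
qed

lemma affine_in_polys: "(\<lambda>x. a \<bullet> x + b) \<in> polys 1"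
proof -
  have "(\<lambda>x. (a $ 1 * x $ 1 + a $ 2 * x $ 2) + b) \<in> polys 1"
    by (intro polys_add polys_scale coordinate_in_polys polys_const) auto
  then show ?thesis by (simp add: inner_vec_def sum_2)
qed

lemma polys_1_affine:
  assumes "f \<in> polys 1"
  shows "\<exists>a b. f = (\<lambda>x. a \<bullet> x + b)"
proof -
  let ?S = "{f. \<exists>a b. f = (\<lambda>x::real^2. a \<bullet> x + b)}"
  have "polys 1 \<subseteq> ?S"
  proof (rule polys_subset_subspace)
    show "fun_subspace ?S"
    proof (rule fun_subspaceI)
      show "(\<lambda>x. 0) \<in> ?S" by (auto intro!: exI[of _ 0])
    next
      fix f g assume "f \<in> ?S" "g \<in> ?S"
      then obtain a b a' b' where "f = (\<lambda>x. a \<bullet> x + b)" "g = (\<lambda>x. a' \<bullet> x + b')" by auto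
      then have "(\<lambda>x. f x + g x) = (\<lambda>x. (a + a') \<bullet> x + (b + b'))" by (auto simp: inner_add_left)
      then show "(\<lambda>x. f x + g x) \<in> ?S" by blast
    next
      fix c f assume "f \<in> ?S"
      then obtain a b where "f = (\<lambda>x. a \<bullet> x + b)" by auto
      then have "(\<lambda>x. c * f x) = (\<lambda>x. (c *\<^sub>R a) \<bullet> x + c * b)" by (auto simp: distrib_left)
      then show "(\<lambda>x. c * f x) \<in> ?S" by blast
    qed
  next
    fix i j :: nat assume "int (i + j) \<le> 1"
    then consider "i = 0" "j = 0" | "i = 1" "j = 0" | "i = 0" "j = 1" by linarith
    then show "(\<lambda>x. (x $ 1) ^ i * (x $ 2) ^ j) \<in> ?S"
    proof cases
      case 1
      then have "(\<lambda>x::real^2. (x $ 1) ^ i * (x $ 2) ^ j) = (\<lambda>x. 0 \<bullet> x + 1)" by auto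
      then show ?thesis by blast
    next
      case 2
      then have "(\<lambda>x::real^2. (x $ 1) ^ i * (x $ 2) ^ j) = (\<lambda>x. axis 1 1 \<bullet> x + 0)"
        by (auto simp: inner_axis')
      then show ?thesis by blast
    next
      case 3
      then have "(\<lambda>x::real^2. (x $ 1) ^ i * (x $ 2) ^ j) = (\<lambda>x. axis 2 1 \<bullet> x + 0)"
        by (auto simp: inner_axis')
      then show ?thesis by blast
    qed
  qed
  then show ?thesis using assms by blast
qed

lemma polys_0_const:
  assumes "f \<in> polys 0"
  shows "\<exists>c. f = (\<lambda>x. c)"
proof -
  have "polys 0 \<subseteq> {f. \<exists>c. f = (\<lambda>x. c)}"
  proof (rule polys_subset_subspace)
    fix i j :: nat assume "int (i + j) \<le> 0"
    then have "i = 0" "j = 0" by auto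
    then show "(\<lambda>x. (x $ 1) ^ i * (x $ 2) ^ j) \<in> {f. \<exists>c. f = (\<lambda>x. c)}" by auto
  qed (auto intro!: fun_subspaceI)
  then show ?thesis using assms by blast
qed

text \<open>
  Affine coordinates of the plane. Spanning the affine functions together with the constant is
  the form in which the property enters the degree inductions.
\<close>
definition affine_coords :: "(real ^ 2 \<Rightarrow> real) \<Rightarrow> (real ^ 2 \<Rightarrow> real) \<Rightarrow> bool" where
  "affine_coords l m \<longleftrightarrow> l \<in> polys 1 \<and> m \<in> polys 1 \<and>
     (\<forall>f\<in>polys 1. \<exists>A B C. f = (\<lambda>x. A + B * l x + C * m x))"

lemma affine_coords_inj:
  assumes "affine_coords l m" "l x = l y" "m x = m y"
  shows "x = y"
proof -
  have eq: "f x = f y" if "f \<in> polys 1" for f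
    using assms that unfolding affine_coords_def by force
  then have "x $ 1 = y $ 1" "x $ 2 = y $ 2"
    using eq[OF coordinate_in_polys(1)] eq[OF coordinate_in_polys(2)] by auto
  then show ?thesis by (simp add: vec_eq_iff forall_2)
qed

lemma affine_coords_det:
  assumes "a $ 1 * a' $ 2 - a $ 2 * a' $ 1 \<noteq> 0"
  shows "affine_coords (\<lambda>x. a \<bullet> x + b) (\<lambda>x. a' \<bullet> x + b')"
  unfolding affine_coords_def
proof (intro conjI ballI affine_in_polys)
  fix f assume "f \<in> polys 1"
  then obtain g d where f: "f = (\<lambda>x. g \<bullet> x + d)" using polys_1_affine by blast
  define D where "D = a $ 1 * a' $ 2 - a $ 2 * a' $ 1"
  define B where "B = (g $ 1 * a' $ 2 - g $ 2 * a' $ 1) / D"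
  define C where "C = (a $ 1 * g $ 2 - a $ 2 * g $ 1) / D"
  have D: "D \<noteq> 0" using assms by (simp add: D_def)
  have "D * g $ 1 = D * (B * a $ 1 + C * a' $ 1)" "D * g $ 2 = D * (B * a $ 2 + C * a' $ 2)"
    using D unfolding B_def C_def by (simp_all add: field_simps) (simp_all add: D_def algebra_simps)
  then have g: "g $ 1 = B * a $ 1 + C * a' $ 1" "g $ 2 = B * a $ 2 + C * a' $ 2" using D by auto
  have "f = (\<lambda>x. (d - B * b - C * b') + B * (a \<bullet> x + b) + C * (a' \<bullet> x + b'))"
    unfolding f by (rule ext) (simp add: inner_vec_def sum_2 g algebra_simps)
  then show "\<exists>A B C. f = (\<lambda>x. A + B * (a \<bullet> x + b) + C * (a' \<bullet> x + b'))" by blast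
qed

text \<open>
  The form of the degree induction for a concrete description of the polynomials: it suffices
  that the description survives multiplication by two coordinates adapted to the situation.
\<close>
lemma polys_step_coords:
  assumes c: "affine_coords l m" and S: "fun_subspace S"
    and "polys (int k) \<subseteq> S'"
    and "\<And>g. g \<in> S' \<Longrightarrow> g \<in> S"
    and "\<And>g. g \<in> S' \<Longrightarrow> (\<lambda>x. l x * g x) \<in> S"
    and "\<And>g. g \<in> S' \<Longrightarrow> (\<lambda>x. m x * g x) \<in> S"
  shows "polys (int (Suc k)) \<subseteq> S"
proof (rule polys_step[OF S])
  fix f g assume f: "f \<in> polys 1" and "g \<in> polys (int k)"
  then have g: "g \<in> S'" using assms by blast
  obtain A B C where "f = (\<lambda>x. A + B * l x + C * m x)"
    using c f unfolding affine_coords_def by blast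
  then have *: "(\<lambda>x. f x * g x) = (\<lambda>x. A * g x) + (\<lambda>x. B * (l x * g x)) + (\<lambda>x. C * (m x * g x))"
    by (auto simp: plus_fun_def algebra_simps)
  show "(\<lambda>x. f x * g x) \<in> S" unfolding *
    by (intro fun_space.subspace_add[OF S] fun_space.subspace_scale[OF S] assms(4-6) g)
qed

text \<open>
  A strict bound, so that \<open>n = 0\<close> leaves only the zero polynomial. This is the right reading
  of a degree bound \<open>r - 3\<close> for \<open>r = 2\<close>.
\<close>
definition deg_less :: "nat \<Rightarrow> real poly set" where
  "deg_less n = {p. \<forall>j\<ge>n. coeff p j = 0}"

lemma deg_less_0: "p \<in> deg_less 0 \<longleftrightarrow> p = 0"
  by (auto simp: deg_less_def poly_eq_iff)

lemma deg_less_zero [simp]: "0 \<in> deg_less n"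
  by (auto simp: deg_less_def)

lemma deg_less_add: "p \<in> deg_less n \<Longrightarrow> q \<in> deg_less n \<Longrightarrow> p + q \<in> deg_less n"
  by (auto simp: deg_less_def)

lemma deg_less_smult: "p \<in> deg_less n \<Longrightarrow> smult c p \<in> deg_less n"
  by (auto simp: deg_less_def)

lemma deg_less_pCons: "p \<in> deg_less n \<Longrightarrow> pCons c p \<in> deg_less (Suc n)"
  by (auto simp: deg_less_def coeff_pCons split: nat.split)

lemma deg_less_mono: "p \<in> deg_less n \<Longrightarrow> n \<le> m \<Longrightarrow> p \<in> deg_less m"
  by (auto simp: deg_less_def)

lemma deg_less_monom: "j < n \<Longrightarrow> monom c j \<in> deg_less n"
  by (auto simp: deg_less_def)

lemma poly_deg_less_sum:
  assumes "p \<in> deg_less n"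
  shows "poly p x = (\<Sum>j<n. coeff p j * x ^ j)"
proof -
  have "poly p x = (\<Sum>j\<le>degree p. coeff p j * x ^ j)" by (rule poly_altdef)
  also have "\<dots> = (\<Sum>j\<le>max n (degree p). coeff p j * x ^ j)"
    by (rule sum.mono_neutral_left) (auto simp: coeff_eq_0)
  also have "\<dots> = (\<Sum>j<n. coeff p j * x ^ j)"
    by (rule sum.mono_neutral_right) (use assms in \<open>auto simp: deg_less_def\<close>)
  finally show ?thesis .
qed

lemma deg_less_roots:
  assumes p: "p \<in> deg_less n" and A: "finite A" "n \<le> card A" and z: "\<And>x. x \<in> A \<Longrightarrow> poly p x = 0"
  shows "p = 0"
proof (rule ccontr)
  assume "p \<noteq> 0"
  have "card A \<le> card {x. poly p x = 0}"
    by (rule card_mono) (use z poly_roots_finite[OF \<open>p \<noteq> 0\<close>] in auto)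
  also have "\<dots> \<le> degree p" by (rule card_poly_roots_bound) fact
  also have "\<dots> < n" using p \<open>p \<noteq> 0\<close> unfolding deg_less_def
    by (metis (mono_tags, lifting) leading_coeff_0_iff linorder_not_le mem_Collect_eq)
  finally show False using A by simp
qed

lemma poly_comp_in_polys:
  assumes t: "t \<in> polys 1" and p: "p \<in> deg_less n"
  shows "(\<lambda>x. poly p (t x)) \<in> polys (int n - 1)"
  using p
proof (induction n arbitrary: p)
  case 0
  then show ?case by (simp add: deg_less_0 polys_zero)
next
  case (Suc n)
  obtain c q where pq: "p = pCons c q" by (cases p)
  have "q \<in> deg_less n" using Suc.prems unfolding pq deg_less_def
    by (auto simp: coeff_pCons split: nat.splits)
  then have "(\<lambda>x. poly q (t x)) \<in> polys (int n - 1)" by (rule Suc.IH)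
  from polys_mult[OF t this] have "(\<lambda>x. t x * poly q (t x)) \<in> polys (int n)" by simp
  then have "(\<lambda>x. c + t x * poly q (t x)) \<in> polys (int n)" by (intro polys_add polys_const) auto
  then show ?case by (simp add: pq)
qed

section \<open>Unisolvence of the Lagrange nodes of a triangle\<close>

text \<open>
  In the coordinates \<open>l\<close>, \<open>m\<close> this collects the monomials free of \<open>l\<close>. It
  replaces the division of a polynomial that vanishes on the line \<open>l = 0\<close>.
\<close>
lemma polys_split_along_line:
  assumes c: "affine_coords l m"
  shows "polys (int k) \<subseteq>
    {\<lambda>x. poly C (m x) + l x * q x | C q. C \<in> deg_less (Suc k) \<and> q \<in> polys (int k - 1)}"
proof (induction k)
  case 0
  show ?case
  proof
    fix f assume "f \<in> polys (int 0)"
    then obtain d where d: "f = (\<lambda>x. d)" using polys_0_const by auto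
    show "f \<in> {\<lambda>x. poly C (m x) + l x * q x | C q. C \<in> deg_less (Suc 0) \<and> q \<in> polys (int 0 - 1)}"
      by (rule CollectI, rule exI[of _ "[:d:]"], rule exI[of _ "\<lambda>x. 0"])
        (auto simp: d polys_zero intro!: deg_less_pCons)
  qed
next
  case (Suc k)
  let ?S = "\<lambda>k. {\<lambda>x. poly C (m x) + l x * q x | C q. C \<in> deg_less (Suc k) \<and> q \<in> polys (int k - 1)}"
  have SI: "f \<in> ?S k" if "C \<in> deg_less (Suc k)" "q \<in> polys (int k - 1)"
    "\<And>x. f x = poly C (m x) + l x * q x" for f C q k
    using that by blast
  have l: "l \<in> polys 1" and m: "m \<in> polys 1" using c by (auto simp: affine_coords_def)
  show ?case
  proof (rule polys_step_coords[OF c _ Suc.IH])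
    show "fun_subspace (?S (Suc k))"
    proof (rule fun_subspaceI)
      show "(\<lambda>x. 0) \<in> ?S (Suc k)" by (rule SI[of 0 _ "\<lambda>x. 0"]) (auto intro: polys_zero)
    next
      fix f g assume "f \<in> ?S (Suc k)" "g \<in> ?S (Suc k)"
      then obtain C q C' q' where
        *: "f = (\<lambda>x. poly C (m x) + l x * q x)" "g = (\<lambda>x. poly C' (m x) + l x * q' x)"
        "C \<in> deg_less (Suc (Suc k))" "C' \<in> deg_less (Suc (Suc k))"
        "q \<in> polys (int (Suc k) - 1)" "q' \<in> polys (int (Suc k) - 1)" by blast
      show "(\<lambda>x. f x + g x) \<in> ?S (Suc k)"
        by (rule SI[OF deg_less_add[OF *(3,4)] polys_add[OF *(5,6)]]) (simp add: * algebra_simps)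
    next
      fix d f assume "f \<in> ?S (Suc k)"
      then obtain C q where
        *: "f = (\<lambda>x. poly C (m x) + l x * q x)"
        "C \<in> deg_less (Suc (Suc k))" "q \<in> polys (int (Suc k) - 1)" by blast
      show "(\<lambda>x. d * f x) \<in> ?S (Suc k)"
        by (rule SI[OF deg_less_smult[OF *(2)] polys_scale[OF *(3)]]) (simp add: * algebra_simps)
    qed
  next
    fix g assume "g \<in> ?S k"
    then obtain C q where g: "g = (\<lambda>x. poly C (m x) + l x * q x)"
      and C: "C \<in> deg_less (Suc k)" and q: "q \<in> polys (int k - 1)" by blast
    have q': "q \<in> polys (int k)" using q polys_mono[of "int k - 1" "int k"] by auto
    show "g \<in> ?S (Suc k)"
      by (rule SI[OF deg_less_mono[OF C]]) (auto simp: g q')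
    have "(\<lambda>x. poly C (m x)) \<in> polys (int (Suc k) - 1)" by (rule poly_comp_in_polys[OF m C])
    moreover have lq: "(\<lambda>x. l x * q x) \<in> polys (int k)" "(\<lambda>x. m x * q x) \<in> polys (int k)"
      using polys_mult[OF l q] polys_mult[OF m q] by auto
    ultimately have "g \<in> polys (int (Suc k) - 1)" unfolding g using polys_add by auto
    then show "(\<lambda>x. l x * g x) \<in> ?S (Suc k)" by (intro SI[of 0]) auto
    show "(\<lambda>x. m x * g x) \<in> ?S (Suc k)"
      by (rule SI[OF deg_less_pCons[OF C, of 0], of "\<lambda>x. m x * q x"])
        (use lq in \<open>auto simp: g algebra_simps\<close>)
  qed
qed

lemma affine_coords_shift:
  assumes "affine_coords l m"
  shows "affine_coords (\<lambda>x. l x - d) m"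
  unfolding affine_coords_def
proof (intro conjI ballI)
  show "m \<in> polys 1" using assms by (simp add: affine_coords_def)
  have "(\<lambda>x. l x + (- d)) \<in> polys 1"
    using assms by (intro polys_add polys_const) (simp_all add: affine_coords_def)
  then show "(\<lambda>x. l x - d) \<in> polys 1" by simp
  fix f assume "f \<in> polys 1"
  then obtain A B C where "f = (\<lambda>x. A + B * l x + C * m x)"
    using assms by (auto simp: affine_coords_def)
  then have "f = (\<lambda>x. (A + B * d) + B * (l x - d) + C * m x)" by (auto simp: algebra_simps)
  then show "\<exists>A B C. f = (\<lambda>x. A + B * (l x - d) + C * m x)" by blast
qed

text \<open>
  The \<open>k + 1\<close> grid points on the line \<open>l = 0\<close> kill the part of \<open>p\<close> that depends on
  \<open>m\<close> alone. What is left is \<open>l q\<close>, and \<open>q\<close> vanishes on the remaining points, which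
  form the grid of order \<open>k - 1\<close> with respect to the coordinate \<open>l - 1\<close>.
\<close>
lemma polys_zero_on_grid:
  assumes "affine_coords l m" and "p \<in> polys (int k)"
    and "\<And>i j. i + j \<le> k \<Longrightarrow> p (X i j) = 0"
    and "\<And>i j. i + j \<le> k \<Longrightarrow> l (X i j) = real i \<and> m (X i j) = real j"
  shows "p = (\<lambda>x. 0)"
  using assms
proof (induction k arbitrary: l p X)
  case 0
  then obtain d where d: "p = (\<lambda>x. d)" using polys_0_const by auto
  then show ?case using "0.prems"(3)[of 0 0] by simp
next
  case (Suc k)
  obtain C q where p: "p = (\<lambda>x. poly C (m x) + l x * q x)"
    and C: "C \<in> deg_less (Suc (Suc k))" and q: "q \<in> polys (int k)"
    using polys_split_along_line[OF Suc.prems(1), of "Suc k"] Suc.prems(2) by auto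
  have "C = 0"
  proof (rule deg_less_roots[OF C, of "real ` {..Suc k}"])
    fix y assume "y \<in> real ` {..Suc k}"
    then obtain j where j: "j \<le> Suc k" "y = real j" by auto
    show "poly C y = 0" using Suc.prems(3)[of 0 j] Suc.prems(4)[of 0 j] j by (simp add: p)
  qed (auto simp: card_image)
  moreover have "q = (\<lambda>x. 0)"
  proof (rule Suc.IH[of "\<lambda>x. l x - 1", where X = "\<lambda>i j. X (Suc i) j"])
    show "affine_coords (\<lambda>x. l x - 1) m" by (rule affine_coords_shift) fact
    fix i j assume ij: "i + j \<le> k"
    then have X: "l (X (Suc i) j) = real (Suc i)" "m (X (Suc i) j) = real j"
      using Suc.prems(4)[of "Suc i" j] by auto
    then show "l (X (Suc i) j) - 1 = real i \<and> m (X (Suc i) j) = real j" by simp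
    show "q (X (Suc i) j) = 0"
      using Suc.prems(3)[of "Suc i" j] ij X \<open>C = 0\<close> by (simp add: p)
  qed (rule q)
  ultimately show ?case by (simp add: p)
qed

lemma affine_coords_basis:
  fixes o' d1 d2 :: "real ^ 2"
  assumes "d1 $ 1 * d2 $ 2 - d1 $ 2 * d2 $ 1 \<noteq> 0"
  shows "\<exists>l m. affine_coords l m \<and>
    (\<forall>s t. l (o' + s *\<^sub>R d1 + t *\<^sub>R d2) = s \<and> m (o' + s *\<^sub>R d1 + t *\<^sub>R d2) = t)"
proof -
  define D where "D = d1 $ 1 * d2 $ 2 - d1 $ 2 * d2 $ 1"
  have D: "D \<noteq> 0" using assms by (simp add: D_def)
  \<comment> \<open>The rows of the inverse of the matrix with columns \<open>d1\<close> and \<open>d2\<close>.\<close>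
  define a :: "real^2" where "a = vector [d2 $ 2 / D, - d2 $ 1 / D]"
  define a' :: "real^2" where "a' = vector [- d1 $ 2 / D, d1 $ 1 / D]"
  have "(a $ 1 * a' $ 2 - a $ 2 * a' $ 1) * D\<^sup>2 = D"
    using D by (simp add: a_def a'_def field_simps power2_eq_square) (simp add: D_def algebra_simps)
  then have "a $ 1 * a' $ 2 - a $ 2 * a' $ 1 \<noteq> 0" using D by auto
  then have "affine_coords (\<lambda>x. a \<bullet> x + (- (a \<bullet> o'))) (\<lambda>x. a' \<bullet> x + (- (a' \<bullet> o')))"
    by (rule affine_coords_det)
  moreover have "a \<bullet> d1 = 1" "a \<bullet> d2 = 0" "a' \<bullet> d1 = 0" "a' \<bullet> d2 = 1"
    using D by (simp_all add: a_def a'_def inner_vec_def sum_2 field_simps) (simp_all add: D_def)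
  ultimately show ?thesis
    by (intro exI[of _ "\<lambda>x. a \<bullet> x + (- (a \<bullet> o'))"] exI[of _ "\<lambda>x. a' \<bullet> x + (- (a' \<bullet> o'))"])
      (auto simp: inner_add_right)
qed

lemma multiple_if_det_0:
  fixes u v :: "real ^ 2"
  assumes det: "v $ 1 * u $ 2 - v $ 2 * u $ 1 = 0" and u: "u \<noteq> 0"
  shows "\<exists>c. v = c *\<^sub>R u"
proof -
  have n: "u \<bullet> u \<noteq> 0" using u by simp
  have "(u \<bullet> u) *\<^sub>R v = (v \<bullet> u) *\<^sub>R u"
    using det by (simp add: vec_eq_iff forall_2 inner_vec_def sum_2 algebra_simps)
  then have "v = ((v \<bullet> u) / (u \<bullet> u)) *\<^sub>R u"
    using n by (simp add: vec_eq_iff field_simps)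
  then show ?thesis by blast
qed

lemma collinear_if_det_0:
  fixes a b c :: "real ^ 2"
  assumes "(a - c) $ 1 * (b - c) $ 2 - (a - c) $ 2 * (b - c) $ 1 = 0"
  shows "collinear {a, b, c}"
proof (cases "b = c")
  case False
  then have "collinear {0, b - c, a - c}"
    using multiple_if_det_0[OF assms] by (auto simp: collinear_lemma)
  then have "collinear {b, c, a}" by (subst collinear_3) auto
  then show ?thesis by (simp add: insert_commute)
qed simp

lemma polys_zero_on_lagrange_nodes:
  assumes N: "lagrange_nodes k T N" and p: "p \<in> polys (int k)" and z: "\<And>x. x \<in> N \<Longrightarrow> p x = 0"
  shows "p = (\<lambda>x. 0)"
proof (cases "k = 0")
  case True
  then obtain d where d: "p = (\<lambda>x. d)" using p polys_0_const by auto
  obtain y where "y \<in> N" using N True by (auto simp: lagrange_nodes_def)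
  then show ?thesis using z d by auto
next
  case False
  obtain a b c where nc: "\<not> collinear {a, b, c}"
    and Neq: "N = {(real i / real k) *\<^sub>R a + (real j / real k) *\<^sub>R b + (real m / real k) *\<^sub>R c
                   | i j m. i + j + m = k}"
    using N False by (auto simp: lagrange_nodes_def)
  define d1 where "d1 = (1 / real k) *\<^sub>R (a - c)"
  define d2 where "d2 = (1 / real k) *\<^sub>R (b - c)"
  have "d1 $ 1 * d2 $ 2 - d1 $ 2 * d2 $ 1 =
      ((a - c) $ 1 * (b - c) $ 2 - (a - c) $ 2 * (b - c) $ 1) / (real k)\<^sup>2"
    using False by (simp add: d1_def d2_def power2_eq_square field_simps)
  also have "\<dots> \<noteq> 0" using nc collinear_if_det_0[of a c b] False by auto
  finally obtain l m where lm: "affine_coords l m"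
    "\<And>s t. l (c + s *\<^sub>R d1 + t *\<^sub>R d2) = s \<and> m (c + s *\<^sub>R d1 + t *\<^sub>R d2) = t"
    using affine_coords_basis[of d1 d2 c] by blast
  show ?thesis
  proof (rule polys_zero_on_grid[OF lm(1) p, of "\<lambda>i j. c + real i *\<^sub>R d1 + real j *\<^sub>R d2"])
    fix i j assume ij: "i + j \<le> k"
    have "c + real i *\<^sub>R d1 + real j *\<^sub>R d2 =
      (real i / real k) *\<^sub>R a + (real j / real k) *\<^sub>R b + (real (k - i - j) / real k) *\<^sub>R c"
      using ij False by (simp add: vec_eq_iff d1_def d2_def of_nat_diff field_simps)
    moreover have "i + j + (k - i - j) = k" using ij by simp
    ultimately have "c + real i *\<^sub>R d1 + real j *\<^sub>R d2 \<in> N" unfolding Neq by blast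
    then show "p (c + real i *\<^sub>R d1 + real j *\<^sub>R d2) = 0" by (rule z)
  qed (simp add: lm(2))
qed

section \<open>Frames adapted to a pair of opposite edges\<close>

text \<open>
  What the parallel and the nonparallel case have in common for the lines \<open>u = 0\<close> and
  \<open>w = 0\<close> of two opposite edges, the admissible function \<open>t\<close> and the auxiliary function
  \<open>z\<close>. For nonparallel edges \<open>a u + b w = t - \<gamma>\<close>, where \<open>a\<close>, \<open>b\<close>, \<open>\<gamma>\<close> are the
  coefficients of \<open>t\<close>; for parallel edges \<open>u + w\<close> is the constant distance of the two
  lines, hence \<open>c = 0\<close>. In both cases \<open>e \<noteq> 0\<close>, which is where \<open>\<gamma> \<noteq> 0\<close>
  is used.
\<close>
definition edge_pair_frame ::
  "(real ^ 2 \<Rightarrow> real) \<Rightarrow> (real ^ 2 \<Rightarrow> real) \<Rightarrow> (real ^ 2 \<Rightarrow> real) \<Rightarrow> (real ^ 2 \<Rightarrow> real) \<Rightarrow>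
   real \<Rightarrow> real \<Rightarrow> bool" where
  "edge_pair_frame u w t z \<eta> \<xi> \<longleftrightarrow>
     u \<in> polys 1 \<and> w \<in> polys 1 \<and> affine_coords t z \<and> \<eta> > 0 \<and> \<xi> > 0 \<and>
     (\<exists>a b c e. e \<noteq> 0 \<and> (\<forall>x. a * u x + b * w x = c * t x + e \<and>
        z x = \<xi> * (a * u x) - \<eta> * (b * w x)))"

lemma edge_pair_frameE:
  assumes "edge_pair_frame u w t z \<eta> \<xi>"
  obtains a b c e where "e \<noteq> 0" "\<And>x. a * u x + b * w x = c * t x + e"
    "\<And>x. z x = \<xi> * (a * u x) - \<eta> * (b * w x)"
proof -
  have "\<exists>a b c e. e \<noteq> 0 \<and> (\<forall>x. a * u x + b * w x = c * t x + e \<and>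
        z x = \<xi> * (a * u x) - \<eta> * (b * w x))"
    using assms by (simp only: edge_pair_frame_def simp_thms)
  then obtain a b c e where "e \<noteq> 0" and *: "\<forall>x. a * u x + b * w x = c * t x + e \<and>
        z x = \<xi> * (a * u x) - \<eta> * (b * w x)" by (elim exE conjE)
  show ?thesis using \<open>e \<noteq> 0\<close> by (rule that) (rule *[rule_format, THEN conjunct1] *[rule_format, THEN conjunct2])+
qed

lemma deg_less_linear_mult: "p \<in> deg_less n \<Longrightarrow> [:e, c:] * p \<in> deg_less (Suc n)"
proof -
  assume p: "p \<in> deg_less n"
  have "[:e, c:] * p = smult e p + pCons 0 (smult c p)" by simp
  moreover have "smult e p \<in> deg_less (Suc n)" using deg_less_smult[OF p] by (rule deg_less_mono) simp
  ultimately show ?thesis using p by (simp only: deg_less_add deg_less_pCons deg_less_smult)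
qed

text \<open>
  By induction on \<open>k\<close>, multiplying by the coordinates \<open>t\<close> and \<open>z\<close>. Only \<open>z\<close> times
  \<open>z D(t)\<close> leaves the stated form. There \<open>z\<^sup>2\<close> is eliminated by the identity
  \<open>(z + \<eta> s) (z - \<xi> s) = - (\<xi> + \<eta>)\<^sup>2 a b u w\<close> with \<open>s = c t + e\<close>.
\<close>
lemma polys_split_along_edge_pair:
  assumes F: "edge_pair_frame u w t z \<eta> \<xi>"
  shows "polys (int k) \<subseteq>
    {\<lambda>x. poly C (t x) + z x * poly D (t x) + u x * w x * p x | C D p.
       C \<in> deg_less (Suc k) \<and> D \<in> deg_less k \<and> p \<in> polys (int k - 2)}"
proof (induction k)
  case 0
  show ?case
  proof
    fix f assume "f \<in> polys (int 0)"
    then obtain d where d: "f = (\<lambda>x. d)" using polys_0_const by auto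
    show "f \<in> {\<lambda>x. poly C (t x) + z x * poly D (t x) + u x * w x * p x | C D p.
       C \<in> deg_less (Suc 0) \<and> D \<in> deg_less 0 \<and> p \<in> polys (int 0 - 2)}"
      by (rule CollectI, rule exI[of _ "[:d:]"], rule exI[of _ 0], rule exI[of _ "\<lambda>x. 0"])
        (auto simp: d polys_zero intro!: deg_less_pCons)
  qed
next
  case (Suc k)
  let ?S = "\<lambda>k. {\<lambda>x. poly C (t x) + z x * poly D (t x) + u x * w x * p x | C D p.
       C \<in> deg_less (Suc k) \<and> D \<in> deg_less k \<and> p \<in> polys (int k - 2)}"
  have SI: "f \<in> ?S k" if "C \<in> deg_less (Suc k)" "D \<in> deg_less k" "p \<in> polys (int k - 2)"
    "\<And>x. f x = poly C (t x) + z x * poly D (t x) + u x * w x * p x" for f C D p k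
    using that by blast
  have co: "affine_coords t z" and t: "t \<in> polys 1" and z: "z \<in> polys 1"
    using F by (auto simp: edge_pair_frame_def affine_coords_def)
  obtain a b c e where fr: "\<And>x. a * u x + b * w x = c * t x + e"
      "\<And>x. z x = \<xi> * (a * u x) - \<eta> * (b * w x)"
    by (rule edge_pair_frameE[OF F]) (rule that)
  define K where "K = (\<xi> + \<eta>)\<^sup>2 * a * b"
  have z2: "z x * z x = (\<xi> - \<eta>) * (e + c * t x) * z x + \<xi> * \<eta> * (e + c * t x)\<^sup>2 - K * (u x * w x)" for x
  proof -
    have s: "e + c * t x = a * u x + b * w x" using fr(1)[of x] by simp
    show ?thesis unfolding K_def s fr(2) by (simp add: power2_eq_square algebra_simps)
  qed
  show ?case
  proof (rule polys_step_coords[OF co _ Suc.IH])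
    show "fun_subspace (?S (Suc k))"
    proof (rule fun_subspaceI)
      show "(\<lambda>x. 0) \<in> ?S (Suc k)" by (rule SI[of 0 _ 0 "\<lambda>x. 0"]) (auto intro: polys_zero)
    next
      fix f g assume "f \<in> ?S (Suc k)" "g \<in> ?S (Suc k)"
      then obtain C D p C' D' p' where
        *: "f = (\<lambda>x. poly C (t x) + z x * poly D (t x) + u x * w x * p x)"
           "g = (\<lambda>x. poly C' (t x) + z x * poly D' (t x) + u x * w x * p' x)"
        "C \<in> deg_less (Suc (Suc k))" "C' \<in> deg_less (Suc (Suc k))"
        "D \<in> deg_less (Suc k)" "D' \<in> deg_less (Suc k)"
        "p \<in> polys (int (Suc k) - 2)" "p' \<in> polys (int (Suc k) - 2)" by blast
      show "(\<lambda>x. f x + g x) \<in> ?S (Suc k)"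
        by (rule SI[OF deg_less_add[OF *(3,4)] deg_less_add[OF *(5,6)] polys_add[OF *(7,8)]])
          (simp add: * algebra_simps)
    next
      fix d f assume "f \<in> ?S (Suc k)"
      then obtain C D p where
        *: "f = (\<lambda>x. poly C (t x) + z x * poly D (t x) + u x * w x * p x)"
        "C \<in> deg_less (Suc (Suc k))" "D \<in> deg_less (Suc k)" "p \<in> polys (int (Suc k) - 2)" by blast
      show "(\<lambda>x. d * f x) \<in> ?S (Suc k)"
        by (rule SI[OF deg_less_smult[OF *(2)] deg_less_smult[OF *(3)] polys_scale[OF *(4)]])
          (simp add: * algebra_simps)
    qed
  next
    fix g assume "g \<in> ?S k"
    then obtain C D p where g: "g = (\<lambda>x. poly C (t x) + z x * poly D (t x) + u x * w x * p x)"
      and C: "C \<in> deg_less (Suc k)" and D: "D \<in> deg_less k" and p: "p \<in> polys (int k - 2)" by blast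
    have p': "p \<in> polys (int (Suc k) - 2)"
      using p polys_mono[of "int k - 2" "int (Suc k) - 2"] by auto
    show "g \<in> ?S (Suc k)"
      by (rule SI[OF deg_less_mono[OF C] deg_less_mono[OF D] p']) (auto simp: g)
    have e1: "1 + (int k - 2) = int (Suc k) - 2" by simp
    have tp: "(\<lambda>x. t x * p x) \<in> polys (int (Suc k) - 2)"
      and zp: "(\<lambda>x. z x * p x) \<in> polys (int (Suc k) - 2)"
      using polys_mult[OF t p] polys_mult[OF z p] unfolding e1 by auto
    show "(\<lambda>x. t x * g x) \<in> ?S (Suc k)"
      by (rule SI[OF deg_less_pCons[OF C, of 0] deg_less_pCons[OF D, of 0] tp])
        (auto simp: g algebra_simps)
    have e2: "int k - 1 = int (Suc k) - 2" by simp
    have Dt: "(\<lambda>x. poly D (t x)) \<in> polys (int (Suc k) - 2)"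
      using poly_comp_in_polys[OF t D] unfolding e2 .
    have C': "smult (\<xi> * \<eta>) ([:e, c:] * ([:e, c:] * D)) \<in> deg_less (Suc (Suc k))"
      by (intro deg_less_smult deg_less_linear_mult D)
    have D': "C + smult (\<xi> - \<eta>) ([:e, c:] * D) \<in> deg_less (Suc k)"
      by (intro deg_less_add C deg_less_smult deg_less_linear_mult D)
    show "(\<lambda>x. z x * g x) \<in> ?S (Suc k)"
    proof (rule SI[OF C' D' polys_add[OF zp polys_scale[OF Dt, of "- K"]]])
      fix x
      have "z x * g x = z x * poly C (t x) + (z x * z x) * poly D (t x) + u x * w x * (z x * p x)"
        by (simp add: g algebra_simps)
      then show "z x * g x = poly (smult (\<xi> * \<eta>) ([:e, c:] * ([:e, c:] * D))) (t x) +
         z x * poly (C + smult (\<xi> - \<eta>) ([:e, c:] * D)) (t x) +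
         u x * w x * (z x * p x + - K * poly D (t x))"
        unfolding z2 by (simp add: algebra_simps power2_eq_square)
    qed
  qed
qed

text \<open>
  On either line \<open>z\<close> is a function of \<open>t\<close>, so \<open>t\<close> separates the points of the line, and
  the assumptions say that \<open>C - \<eta> G\<close> and \<open>C + \<xi> G\<close> have \<open>r - 1\<close> zeros although their
  degree is at most \<open>r - 2\<close>, where \<open>G = (c t + e) D + \<sigma> t\<^bsup>r-2\<^esup>\<close>. If \<open>c \<noteq> 0\<close>,
  evaluating \<open>G\<close> at the nonzero root of \<open>c t + e\<close> isolates \<open>\<sigma>\<close>; if \<open>c = 0\<close>, the
  coefficient of \<open>t\<^bsup>r-2\<^esup>\<close> does.
\<close>
lemma edge_coefficients_zero:
  assumes F: "edge_pair_frame u w t z \<eta> \<xi>" and r: "r \<ge> 2"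
    and C: "C \<in> deg_less (r - 1)" and D: "D \<in> deg_less (r - 2)"
    and N: "finite N" "r - 1 \<le> card N" "finite N'" "r - 1 \<le> card N'"
    and u: "\<And>x. x \<in> N \<Longrightarrow> u x = 0 \<and> poly C (t x) + z x * poly D (t x) + \<sigma> * (- \<eta>) * t x ^ (r - 2) = 0"
    and w: "\<And>x. x \<in> N' \<Longrightarrow> w x = 0 \<and> poly C (t x) + z x * poly D (t x) + \<sigma> * \<xi> * t x ^ (r - 2) = 0"
  shows "C = 0 \<and> D = 0 \<and> \<sigma> = 0"
proof -
  have co: "affine_coords t z" and pos: "\<eta> > 0" "\<xi> > 0" using F by (auto simp: edge_pair_frame_def)
  obtain a b c e where e: "e \<noteq> 0" and fr: "\<And>x. a * u x + b * w x = c * t x + e"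
      "\<And>x. z x = \<xi> * (a * u x) - \<eta> * (b * w x)"
    by (rule edge_pair_frameE[OF F]) (rule that)
  have zu: "z x = - \<eta> * (e + c * t x)" if "u x = 0" for x using fr[of x] that by auto
  have zw: "z x = \<xi> * (e + c * t x)" if "w x = 0" for x using fr[of x] that by auto
  define G where "G = [:e, c:] * D + monom \<sigma> (r - 2)"
  have r1: "r - 1 = Suc (r - 2)" using r by simp
  have G: "G \<in> deg_less (r - 1)" unfolding G_def r1
    by (intro deg_less_add deg_less_linear_mult D deg_less_monom) simp
  have injN: "inj_on t N"
    by (rule inj_onI, rule affine_coords_inj[OF co]) (simp_all add: zu u)
  have injN': "inj_on t N'"
    by (rule inj_onI, rule affine_coords_inj[OF co]) (simp_all add: zw w)
  have 1: "C + smult (- \<eta>) G = 0"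
  proof (rule deg_less_roots[of _ "r - 1" "t ` N"])
    fix y assume "y \<in> t ` N"
    then obtain x where x: "x \<in> N" "y = t x" by auto
    then have z: "z x = - \<eta> * (e + c * t x)" using zu u by blast
    show "poly (C + smult (- \<eta>) G) y = 0"
      using u[OF x(1)] unfolding z by (simp add: x(2) G_def poly_monom algebra_simps)
  qed (use deg_less_add[OF C deg_less_smult[OF G, of "- \<eta>"]] N injN in \<open>auto simp: card_image\<close>)
  have 2: "C + smult \<xi> G = 0"
  proof (rule deg_less_roots[of _ "r - 1" "t ` N'"])
    fix y assume "y \<in> t ` N'"
    then obtain x where x: "x \<in> N'" "y = t x" by auto
    then have z: "z x = \<xi> * (e + c * t x)" using zw w by blast
    show "poly (C + smult \<xi> G) y = 0"
      using w[OF x(1)] unfolding z by (simp add: x(2) G_def poly_monom algebra_simps)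
  qed (use deg_less_add[OF C deg_less_smult[OF G, of \<xi>]] N injN' in \<open>auto simp: card_image\<close>)
  have "smult (\<eta> + \<xi>) G = (C + smult \<xi> G) - (C + smult (- \<eta>) G)" by (simp add: smult_add_left)
  then have "smult (\<eta> + \<xi>) G = 0" using 1 2 by simp
  then have G0: "G = 0" using pos by simp
  then have C0: "C = 0" using 2 by simp
  have "\<sigma> = 0"
  proof (cases "c = 0")
    case True
    have "coeff G (r - 2) = \<sigma>" using D True by (simp add: G_def deg_less_def)
    then show ?thesis using G0 by simp
  next
    case False
    have "poly G (- e / c) = \<sigma> * (- e / c) ^ (r - 2)" using False by (simp add: G_def poly_monom)
    then show ?thesis using G0 e False by simp
  qed
  moreover have "[:e, c:] * D = 0" using G0 \<open>\<sigma> = 0\<close> by (simp add: G_def del: mult_pCons_left)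
  then have "D = 0" using e by (simp only: mult_eq_0_iff pCons_eq_0_iff) simp
  ultimately show ?thesis using C0 by simp
qed

section \<open>Splitting polynomials along the four edges\<close>

text \<open>
  The vector \<open>p - x0\<close> separates the gradients of \<open>l\<close> and \<open>m\<close>, and \<open>q\<close> ensures that \<open>m\<close> is
  not constant; so the gradients are independent.
\<close>
lemma affine_coordsI:
  assumes l: "l \<in> polys 1" and m: "m \<in> polys 1"
    and pts: "l p \<noteq> l x0" "m p = m x0" "m q \<noteq> m x0"
  shows "affine_coords l m"
proof -
  obtain a b where a: "l = (\<lambda>x. a \<bullet> x + b)" using polys_1_affine[OF l] by blast
  obtain a' b' where a': "m = (\<lambda>x. a' \<bullet> x + b')" using polys_1_affine[OF m] by blast
  define p' where "p' = p - x0"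
  define q' where "q' = q - x0"
  have p: "a $ 1 * p' $ 1 + a $ 2 * p' $ 2 \<noteq> 0" "a' $ 1 * p' $ 1 + a' $ 2 * p' $ 2 = 0"
    "a' $ 1 * q' $ 1 + a' $ 2 * q' $ 2 \<noteq> 0"
    using pts by (simp_all add: a a' p'_def q'_def inner_vec_def sum_2 algebra_simps)
  have "a $ 1 * a' $ 2 - a $ 2 * a' $ 1 \<noteq> 0"
  proof
    assume d: "a $ 1 * a' $ 2 - a $ 2 * a' $ 1 = 0"
    have "a' $ 1 * (a $ 1 * p' $ 1 + a $ 2 * p' $ 2) =
        a $ 1 * (a' $ 1 * p' $ 1 + a' $ 2 * p' $ 2) - (a $ 1 * a' $ 2 - a $ 2 * a' $ 1) * p' $ 2"
      "a' $ 2 * (a $ 1 * p' $ 1 + a $ 2 * p' $ 2) =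
        a $ 2 * (a' $ 1 * p' $ 1 + a' $ 2 * p' $ 2) + (a $ 1 * a' $ 2 - a $ 2 * a' $ 1) * p' $ 1"
      by (simp_all add: algebra_simps)
    then have "a' $ 1 = 0" "a' $ 2 = 0" unfolding d p(2) using p(1) by auto
    then show False using p(3) by simp
  qed
  then show ?thesis unfolding a a' by (rule affine_coords_det)
qed

text \<open>
  The lines of \<open>l\<close> and \<open>m\<close> meet in \<open>x0\<close> but the line of \<open>n\<close> misses this point, so
  the constant \<open>1\<close> is a combination of the three functions.
\<close>
lemma affine_basis_of_three:
  assumes c: "affine_coords l m" and n: "n \<in> polys 1"
    and pt: "l x0 = 0" "m x0 = 0" "n x0 \<noteq> 0" and f: "f \<in> polys 1"
  shows "\<exists>A B C. f = (\<lambda>x. A * l x + B * m x + C * n x)"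
proof -
  obtain A B C where A: "f = (\<lambda>x. A + B * l x + C * m x)"
    using c f by (auto simp: affine_coords_def)
  obtain A' B' C' where A': "n = (\<lambda>x. A' + B' * l x + C' * m x)"
    using c n unfolding affine_coords_def by blast
  have "A' \<noteq> 0" using pt by (simp add: A')
  then have "f = (\<lambda>x. (B - A / A' * B') * l x + (C - A / A' * C') * m x + A / A' * n x)"
    by (auto simp: A A' field_simps)
  then show ?thesis by blast
qed

lemma fun_span_add: "f \<in> fun_span S \<Longrightarrow> g \<in> fun_span S \<Longrightarrow> (\<lambda>x. f x + g x) \<in> fun_span S"
  using fun_space.span_add[of f S g] by (simp add: plus_fun_def)

lemma fun_span_scale: "f \<in> fun_span S \<Longrightarrow> (\<lambda>x. c * f x) \<in> fun_span S"
  using fun_space.span_scale[of f S c] by simp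

lemma fun_span_zero: "(\<lambda>x. 0) \<in> fun_span S"
  using fun_space.span_zero[of S] by (simp add: zero_fun_def)

text \<open>
  The signs of the edge functions at the vertices are all that the algebra needs to know about
  the quadrilateral. The vertex \<open>vij\<close> lies on the edges \<open>i\<close> and \<open>j\<close>.
\<close>
locale quadrilateral_functions =
  fixes v13 v14 v23 v24 :: "real ^ 2" and l1 l2 l3 l4 :: "real ^ 2 \<Rightarrow> real"
  assumes affine: "l1 \<in> polys 1" "l2 \<in> polys 1" "l3 \<in> polys 1" "l4 \<in> polys 1"
    and zero: "l1 v13 = 0" "l1 v14 = 0" "l2 v23 = 0" "l2 v24 = 0"
      "l3 v13 = 0" "l3 v23 = 0" "l4 v14 = 0" "l4 v24 = 0"
    and pos: "l1 v23 > 0" "l1 v24 > 0" "l2 v13 > 0" "l2 v14 > 0"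
      "l3 v14 > 0" "l3 v24 > 0" "l4 v13 > 0" "l4 v23 > 0"
begin

lemma adjacent_coords:
  "affine_coords l1 l3" "affine_coords l1 l4" "affine_coords l2 l3" "affine_coords l2 l4"
  using affine_coordsI[OF affine(1,3), of v23 v13 v14] affine_coordsI[OF affine(1,4), of v24 v14 v13]
    affine_coordsI[OF affine(2,3), of v13 v23 v24] affine_coordsI[OF affine(2,4), of v14 v24 v23]
    zero pos by auto

text \<open>
  The polynomials of degree at most \<open>k + 2\<close>, as will turn out. In algebraic terms, the two
  degenerate conics \<open>l1 l2 = 0\<close> and \<open>l3 l4 = 0\<close> meet exactly in the four vertices, and the
  vertex functions represent the values there.
\<close>
definition split_span :: "nat \<Rightarrow> (real ^ 2 \<Rightarrow> real) set" where
  "split_span k = fun_span (vertex_funs l1 l2 l3 l4 \<union>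
     {\<lambda>x. l1 x * l2 x * p x | p. p \<in> polys (int k)} \<union>
     {\<lambda>x. l3 x * l4 x * p x | p. p \<in> polys (int k)})"

lemma subspace_split_span: "fun_subspace (split_span k)"
  unfolding split_span_def by (rule fun_space.subspace_span)

lemma split_span_add: "f \<in> split_span k \<Longrightarrow> g \<in> split_span k \<Longrightarrow> (\<lambda>x. f x + g x) \<in> split_span k"
  unfolding split_span_def by (rule fun_span_add)

lemma split_span_scale: "f \<in> split_span k \<Longrightarrow> (\<lambda>x. c * f x) \<in> split_span k"
  unfolding split_span_def by (rule fun_span_scale)

lemma split_span_vertex:
  "(\<lambda>x. l2 x * l4 x) \<in> split_span k" "(\<lambda>x. l2 x * l3 x) \<in> split_span k"
  "(\<lambda>x. l1 x * l4 x) \<in> split_span k" "(\<lambda>x. l1 x * l3 x) \<in> split_span k"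
  unfolding split_span_def vertex_funs_def by (rule fun_space.span_base; simp)+

lemma split_span_edge:
  assumes "p \<in> polys (int k)"
  shows "(\<lambda>x. l1 x * l2 x * p x) \<in> split_span k" "(\<lambda>x. l3 x * l4 x * p x) \<in> split_span k"
  unfolding split_span_def using assms by (blast intro: fun_space.span_base)+

text \<open>
  A vertex function such as \<open>l2 l4\<close> is multiplied by \<open>f\<close> written in the coordinates
  belonging to the vertex where \<open>l2 l4\<close> does not vanish: the constant term gives \<open>l2 l4\<close>
  back, and each linear term completes one of the products \<open>l1 l2\<close>, \<open>l3 l4\<close>.
\<close>
lemma split_span_mult_vertex:
  assumes f: "f \<in> polys 1" and g: "g \<in> vertex_funs l1 l2 l3 l4"
  shows "(\<lambda>x. f x * g x) \<in> split_span (Suc k)"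
proof -
  have in1: "l1 \<in> polys (int (Suc k))" "l2 \<in> polys (int (Suc k))" "l3 \<in> polys (int (Suc k))"
      "l4 \<in> polys (int (Suc k))"
    using affine polys_mono[of 1 "int (Suc k)"] by auto
  note mem = split_span_add split_span_scale split_span_vertex split_span_edge in1
  from g consider "g = (\<lambda>x. l2 x * l4 x)" | "g = (\<lambda>x. l2 x * l3 x)" | "g = (\<lambda>x. l1 x * l4 x)"
    | "g = (\<lambda>x. l1 x * l3 x)" by (auto simp: vertex_funs_def)
  then show ?thesis
  proof cases
    case 1
    obtain A B C where "f = (\<lambda>x. A + B * l1 x + C * l3 x)"
      using f adjacent_coords unfolding affine_coords_def by blast
    then have "(\<lambda>x. f x * g x) =
        (\<lambda>x. A * (l2 x * l4 x) + B * (l1 x * l2 x * l4 x) + C * (l3 x * l4 x * l2 x))"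
      by (auto simp: 1 algebra_simps)
    also have "\<dots> \<in> split_span (Suc k)" by (intro mem)
    finally show ?thesis .
  next
    case 2
    obtain A B C where "f = (\<lambda>x. A + B * l1 x + C * l4 x)"
      using f adjacent_coords unfolding affine_coords_def by blast
    then have "(\<lambda>x. f x * g x) =
        (\<lambda>x. A * (l2 x * l3 x) + B * (l1 x * l2 x * l3 x) + C * (l3 x * l4 x * l2 x))"
      by (auto simp: 2 algebra_simps)
    also have "\<dots> \<in> split_span (Suc k)" by (intro mem)
    finally show ?thesis .
  next
    case 3
    obtain A B C where "f = (\<lambda>x. A + B * l2 x + C * l3 x)"
      using f adjacent_coords unfolding affine_coords_def by blast
    then have "(\<lambda>x. f x * g x) =
        (\<lambda>x. A * (l1 x * l4 x) + B * (l1 x * l2 x * l4 x) + C * (l3 x * l4 x * l1 x))"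
      by (auto simp: 3 algebra_simps)
    also have "\<dots> \<in> split_span (Suc k)" by (intro mem)
    finally show ?thesis .
  next
    case 4
    obtain A B C where "f = (\<lambda>x. A + B * l2 x + C * l4 x)"
      using f adjacent_coords unfolding affine_coords_def by blast
    then have "(\<lambda>x. f x * g x) =
        (\<lambda>x. A * (l1 x * l3 x) + B * (l1 x * l2 x * l3 x) + C * (l3 x * l4 x * l1 x))"
      by (auto simp: 4 algebra_simps)
    also have "\<dots> \<in> split_span (Suc k)" by (intro mem)
    finally show ?thesis .
  qed
qed

lemma split_span_mult:
  assumes f: "f \<in> polys 1" and g: "g \<in> split_span k"
  shows "(\<lambda>x. f x * g x) \<in> split_span (Suc k)"
proof -
  have "split_span k \<subseteq> {g. (\<lambda>x. f x * g x) \<in> split_span (Suc k)}"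
    unfolding split_span_def[of k]
  proof (rule fun_space.span_minimal)
    show "fun_subspace {g. (\<lambda>x. f x * g x) \<in> split_span (Suc k)}"
    proof (rule fun_subspaceI)
      show "(\<lambda>x. 0) \<in> {g. (\<lambda>x. f x * g x) \<in> split_span (Suc k)}"
        by (simp add: split_span_def fun_span_zero)
      show "(\<lambda>x. g x + h x) \<in> {g. (\<lambda>x. f x * g x) \<in> split_span (Suc k)}"
        if "g \<in> {g. (\<lambda>x. f x * g x) \<in> split_span (Suc k)}"
          "h \<in> {g. (\<lambda>x. f x * g x) \<in> split_span (Suc k)}" for g h
        using that by (simp add: distrib_left split_span_add)
      show "(\<lambda>x. c * g x) \<in> {g. (\<lambda>x. f x * g x) \<in> split_span (Suc k)}"
        if "g \<in> {g. (\<lambda>x. f x * g x) \<in> split_span (Suc k)}" for g c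
        using split_span_scale[of _ _ c] that by (fastforce simp: mult.left_commute[of _ c])
    qed
    have "(\<lambda>x. l1 x * l2 x * (f x * p x)) \<in> split_span (Suc k)"
      "(\<lambda>x. l3 x * l4 x * (f x * p x)) \<in> split_span (Suc k)" if "p \<in> polys (int k)" for p
      using polys_mult[OF f that] by (intro split_span_edge; simp)+
    then show "vertex_funs l1 l2 l3 l4 \<union> {\<lambda>x. l1 x * l2 x * p x | p. p \<in> polys (int k)} \<union>
      {\<lambda>x. l3 x * l4 x * p x | p. p \<in> polys (int k)} \<subseteq> {g. (\<lambda>x. f x * g x) \<in> split_span (Suc k)}"
      using split_span_mult_vertex[OF f] by (auto simp: mult_ac)
  qed
  then show ?thesis using g by blast
qed

text \<open>
  The products of two different edge functions lie in the span by definition. The squares do as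
  well, since each factor of a product can be rewritten as a combination of the three other edge
  functions.
\<close>
lemma quadratic_split: "polys (int (Suc 1)) \<subseteq> split_span 0"
proof (rule polys_step[OF subspace_split_span])
  note mem = split_span_add split_span_scale split_span_vertex
  have one: "(\<lambda>x. 1) \<in> polys (int 0)" by (simp add: polys_const)
  have l12: "(\<lambda>x. l1 x * l2 x) \<in> split_span 0" and l34: "(\<lambda>x. l3 x * l4 x) \<in> split_span 0"
    using split_span_edge[OF one] by simp_all
  have prod: "(\<lambda>x. l1 x * f x) \<in> split_span 0" "(\<lambda>x. l2 x * f x) \<in> split_span 0"
    "(\<lambda>x. l3 x * f x) \<in> split_span 0" if f: "f \<in> polys 1" for f
  proof -
    obtain A B C where "f = (\<lambda>x. A * l2 x + B * l3 x + C * l4 x)"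
      using affine_basis_of_three[OF adjacent_coords(3) affine(4) zero(3,6) _ f] pos by force
    then have "(\<lambda>x. l1 x * f x) = (\<lambda>x. A * (l1 x * l2 x) + B * (l1 x * l3 x) + C * (l1 x * l4 x))"
      by (simp add: algebra_simps)
    also have "\<dots> \<in> split_span 0" by (intro mem l12)
    finally show "(\<lambda>x. l1 x * f x) \<in> split_span 0" .
    obtain A B C where "f = (\<lambda>x. A * l1 x + B * l3 x + C * l4 x)"
      using affine_basis_of_three[OF adjacent_coords(1) affine(4) zero(1,5) _ f] pos by force
    then have "(\<lambda>x. l2 x * f x) = (\<lambda>x. A * (l1 x * l2 x) + B * (l2 x * l3 x) + C * (l2 x * l4 x))"
      by (simp add: algebra_simps)
    also have "\<dots> \<in> split_span 0" by (intro mem l12)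
    finally show "(\<lambda>x. l2 x * f x) \<in> split_span 0" .
    obtain A B C where "f = (\<lambda>x. A * l1 x + B * l4 x + C * l2 x)"
      using affine_basis_of_three[OF adjacent_coords(2) affine(2) zero(2,7) _ f] pos by force
    then have "(\<lambda>x. l3 x * f x) = (\<lambda>x. A * (l1 x * l3 x) + B * (l3 x * l4 x) + C * (l2 x * l3 x))"
      by (simp add: algebra_simps)
    also have "\<dots> \<in> split_span 0" by (intro mem l34)
    finally show "(\<lambda>x. l3 x * f x) \<in> split_span 0" .
  qed
  fix f g assume f: "f \<in> polys 1" and "g \<in> polys (int 1)"
  then have g: "g \<in> polys 1" by simp
  obtain A B C where "g = (\<lambda>x. A * l1 x + B * l3 x + C * l2 x)"
    using affine_basis_of_three[OF adjacent_coords(1) affine(2) zero(1,5) _ g] pos by force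
  then have "(\<lambda>x. f x * g x) = (\<lambda>x. A * (l1 x * f x) + B * (l3 x * f x) + C * (l2 x * f x))"
    by (simp add: algebra_simps)
  also have "\<dots> \<in> split_span 0" by (intro mem prod f)
  finally show "(\<lambda>x. f x * g x) \<in> split_span 0" .
qed

lemma polys_split_along_quadrilateral: "polys (int (Suc (Suc k))) \<subseteq> split_span k"
proof (induction k)
  case 0
  then show ?case using quadratic_split by simp
next
  case (Suc k)
  show ?case
    by (rule polys_step[OF subspace_split_span]) (use Suc split_span_mult in blast)
qed

end

section \<open>Geometry of the quadrilateral\<close>

lemma det_0_if_common_normal:
  fixes g x y :: "real ^ 2"
  assumes "g \<noteq> 0" "g \<bullet> x = 0" "g \<bullet> y = 0"
  shows "x $ 1 * y $ 2 - x $ 2 * y $ 1 = 0"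
proof -
  let ?D = "x $ 1 * y $ 2 - x $ 2 * y $ 1"
  have "g $ 1 * ?D = (g \<bullet> x) * y $ 2 - (g \<bullet> y) * x $ 2" "g $ 2 * ?D = (g \<bullet> y) * x $ 1 - (g \<bullet> x) * y $ 1"
    by (simp_all add: inner_vec_def sum_2 algebra_simps)
  then have "g $ 1 * ?D = 0" "g $ 2 * ?D = 0" using assms by auto
  then show ?thesis using assms(1) by (auto simp: vec_eq_iff forall_2)
qed

lemma edge_linear_segment:
  assumes "edge_linear E (closed_segment a b) l"
  shows "\<exists>g d. norm g = 1 \<and> l = (\<lambda>x. g \<bullet> x + d) \<and> l a = 0 \<and> l b = 0 \<and> (\<forall>y\<in>E. l y \<ge> 0)"
proof -
  obtain \<nu> x0 where n: "unit_outer_normal E (closed_segment a b) \<nu>" and x0: "x0 \<in> closed_segment a b"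
    and l: "l = (\<lambda>x. - ((x - x0) \<bullet> \<nu>))"
    using assms by (auto simp: edge_linear_def)
  have "l = (\<lambda>x. (- \<nu>) \<bullet> x + \<nu> \<bullet> x0)"
    by (rule ext) (simp add: l inner_diff_left inner_commute[of \<nu>])
  moreover have "norm (- \<nu>) = 1" "l a = 0" "l b = 0" "\<forall>y\<in>E. l y \<ge> 0"
    using n x0 by (auto simp: unit_outer_normal_def l)
  ultimately show ?thesis by blast
qed

text \<open>
  Otherwise the three points lie on one line, and the middle one is not extreme.
\<close>
lemma not_zero_at_third_extreme_point:
  fixes E :: "(real ^ 2) set"
  assumes ex: "a extreme_point_of E" "b extreme_point_of E" "c extreme_point_of E"
    and ne: "a \<noteq> b" "a \<noteq> c" "b \<noteq> c"
    and l: "l = (\<lambda>x. g \<bullet> x + d)" "norm g = 1" "l a = 0" "l b = 0"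
  shows "l c \<noteq> 0"
proof
  assume "l c = 0"
  then have "g \<bullet> (a - c) = 0" "g \<bullet> (b - c) = 0" using l by (auto simp: inner_diff_right)
  moreover have "g \<noteq> 0" using l(2) by auto
  ultimately have "collinear {a, b, c}"
    by (intro collinear_if_det_0 det_0_if_common_normal)
  then have "a \<in> open_segment b c \<or> b \<in> open_segment c a \<or> c \<in> open_segment a b"
    using ne by (auto simp: collinear_between_cases between_mem_segment open_segment_def)
  then show False using ex by (auto simp: extreme_point_of_def)
qed

lemma quadrilateral_geometry:
  assumes Q: "convex_quadrilateral E e1 e2 e3 e4"
    and l: "edge_linear E e1 l1" "edge_linear E e2 l2" "edge_linear E e3 l3" "edge_linear E e4 l4"
  obtains v13 v14 v23 v24 g1 d1 g2 d2 g3 d3 g4 d4 where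
    "e1 = closed_segment v13 v14" "e2 = closed_segment v23 v24"
    "e3 = closed_segment v13 v23" "e4 = closed_segment v14 v24"
    "{v. v extreme_point_of E} = {v13, v14, v23, v24}"
    "quadrilateral_functions v13 v14 v23 v24 l1 l2 l3 l4"
    "l1 = (\<lambda>x. g1 \<bullet> x + d1)" "norm g1 = 1" "\<And>y. y \<in> E \<Longrightarrow> l1 y \<ge> 0"
    "l2 = (\<lambda>x. g2 \<bullet> x + d2)" "norm g2 = 1" "\<And>y. y \<in> E \<Longrightarrow> l2 y \<ge> 0"
    "l3 = (\<lambda>x. g3 \<bullet> x + d3)" "norm g3 = 1" "\<And>y. y \<in> E \<Longrightarrow> l3 y \<ge> 0"
    "l4 = (\<lambda>x. g4 \<bullet> x + d4)" "norm g4 = 1" "\<And>y. y \<in> E \<Longrightarrow> l4 y \<ge> 0"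
    "e1 \<subseteq> E" "e2 \<subseteq> E" "e3 \<subseteq> E" "e4 \<subseteq> E"
proof -
  obtain v13 v14 v23 v24 where card: "card {v13, v14, v23, v24} = 4"
    and E: "E = convex hull {v13, v14, v23, v24}"
    and ext: "{v. v extreme_point_of E} = {v13, v14, v23, v24}"
    and e: "e1 = closed_segment v13 v14" "e2 = closed_segment v23 v24"
        "e3 = closed_segment v13 v23" "e4 = closed_segment v14 v24"
    using Q unfolding convex_quadrilateral_def by blast
  obtain g1 d1 where 1: "norm g1 = 1" "l1 = (\<lambda>x. g1 \<bullet> x + d1)" "l1 v13 = 0" "l1 v14 = 0"
      "\<forall>y\<in>E. l1 y \<ge> 0"
    using edge_linear_segment[OF l(1)[unfolded e]] by blast
  obtain g2 d2 where 2: "norm g2 = 1" "l2 = (\<lambda>x. g2 \<bullet> x + d2)" "l2 v23 = 0" "l2 v24 = 0"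
      "\<forall>y\<in>E. l2 y \<ge> 0"
    using edge_linear_segment[OF l(2)[unfolded e]] by blast
  obtain g3 d3 where 3: "norm g3 = 1" "l3 = (\<lambda>x. g3 \<bullet> x + d3)" "l3 v13 = 0" "l3 v23 = 0"
      "\<forall>y\<in>E. l3 y \<ge> 0"
    using edge_linear_segment[OF l(3)[unfolded e]] by blast
  obtain g4 d4 where 4: "norm g4 = 1" "l4 = (\<lambda>x. g4 \<bullet> x + d4)" "l4 v14 = 0" "l4 v24 = 0"
      "\<forall>y\<in>E. l4 y \<ge> 0"
    using edge_linear_segment[OF l(4)[unfolded e]] by blast
  have ne: "v13 \<noteq> v14" "v13 \<noteq> v23" "v13 \<noteq> v24" "v14 \<noteq> v23" "v14 \<noteq> v24" "v23 \<noteq> v24"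
  proof -
    have *: "card {a, b, c} \<le> 3" for a b c :: "real^2"
      by (rule order_trans[OF card_insert_le_m1]) (auto intro!: card_insert_le_m1)
    show "v13 \<noteq> v14" "v13 \<noteq> v23" "v13 \<noteq> v24" "v14 \<noteq> v23" "v14 \<noteq> v24" "v23 \<noteq> v24"
      using card *[of v13 v14 v23] *[of v13 v14 v24] *[of v13 v23 v24] *[of v14 v23 v24]
      by (auto simp: insert_commute)
  qed
  have ex: "v13 extreme_point_of E" "v14 extreme_point_of E" "v23 extreme_point_of E"
      "v24 extreme_point_of E" using ext by auto
  then have inE: "v13 \<in> E" "v14 \<in> E" "v23 \<in> E" "v24 \<in> E" by (auto simp: extreme_point_of_def)
  have nz: "l1 v23 \<noteq> 0" "l1 v24 \<noteq> 0" "l2 v13 \<noteq> 0" "l2 v14 \<noteq> 0" "l3 v14 \<noteq> 0" "l3 v24 \<noteq> 0"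
      "l4 v13 \<noteq> 0" "l4 v23 \<noteq> 0"
    using not_zero_at_third_extreme_point[OF ex(1,2,3) _ _ _ 1(2,1,3,4)]
      not_zero_at_third_extreme_point[OF ex(1,2,4) _ _ _ 1(2,1,3,4)]
      not_zero_at_third_extreme_point[OF ex(3,4,1) _ _ _ 2(2,1,3,4)]
      not_zero_at_third_extreme_point[OF ex(3,4,2) _ _ _ 2(2,1,3,4)]
      not_zero_at_third_extreme_point[OF ex(1,3,2) _ _ _ 3(2,1,3,4)]
      not_zero_at_third_extreme_point[OF ex(1,3,4) _ _ _ 3(2,1,3,4)]
      not_zero_at_third_extreme_point[OF ex(2,4,1) _ _ _ 4(2,1,3,4)]
      not_zero_at_third_extreme_point[OF ex(2,4,3) _ _ _ 4(2,1,3,4)] ne by metis+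
  have aff: "l1 \<in> polys 1" "l2 \<in> polys 1" "l3 \<in> polys 1" "l4 \<in> polys 1"
    unfolding 1(2) 2(2) 3(2) 4(2) by (rule affine_in_polys)+
  have Qf: "quadrilateral_functions v13 v14 v23 v24 l1 l2 l3 l4"
    by (unfold_locales; (fact aff 1 2 3 4 | rule le_neq_trans[OF _ nz(1)[symmetric]]
      le_neq_trans[OF _ nz(2)[symmetric]] le_neq_trans[OF _ nz(3)[symmetric]]
      le_neq_trans[OF _ nz(4)[symmetric]] le_neq_trans[OF _ nz(5)[symmetric]]
      le_neq_trans[OF _ nz(6)[symmetric]] le_neq_trans[OF _ nz(7)[symmetric]]
      le_neq_trans[OF _ nz(8)[symmetric]]; use inE 1(5) 2(5) 3(5) 4(5) in blast))
  have cE: "convex E" unfolding E by (rule convex_convex_hull)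
  have sub: "e1 \<subseteq> E" "e2 \<subseteq> E" "e3 \<subseteq> E" "e4 \<subseteq> E"
    unfolding e by (intro closed_segment_subset inE cE)+
  show ?thesis
    by (rule that[OF e ext Qf 1(2,1) _ 2(2,1) _ 3(2,1) _ 4(2,1) _ sub])
      (use 1(5) 2(5) 3(5) 4(5) in blast)+
qed

text \<open>
  A step of length \<open>\<epsilon> / 2\<close> against the unit gradient stays in \<open>E\<close> and lowers \<open>l\<close> by
  \<open>\<epsilon> / 2\<close>.
\<close>
lemma positive_in_interior:
  fixes E :: "(real ^ 2) set"
  assumes l: "l = (\<lambda>x. g \<bullet> x + d)" "norm g = 1" "\<And>y. y \<in> E \<Longrightarrow> l y \<ge> 0" and x: "x \<in> interior E"
  shows "l x > 0"
proof -
  obtain \<epsilon> where e: "\<epsilon> > 0" "ball x \<epsilon> \<subseteq> E" using x by (auto simp: mem_interior)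
  have "x - (\<epsilon> / 2) *\<^sub>R g \<in> ball x \<epsilon>" using e l(2) by (simp add: dist_norm)
  then have "l (x - (\<epsilon> / 2) *\<^sub>R g) \<ge> 0" using e l(3) by blast
  moreover have "g \<bullet> g = 1" using l(2) by (simp add: dot_square_norm)
  ultimately have "l x \<ge> \<epsilon> / 2" by (simp add: l(1) inner_diff_right)
  then show ?thesis using e by linarith
qed

lemma affine_hull_2_eq_zero_set:
  fixes a b g :: "real ^ 2"
  assumes l: "l = (\<lambda>x. g \<bullet> x + d)" "g \<noteq> 0" "l a = 0" "l b = 0" "a \<noteq> b"
  shows "affine hull {a, b} = {x. l x = 0}"
proof
  show "affine hull {a, b} \<subseteq> {x. l x = 0}"
  proof
    fix x assume "x \<in> affine hull {a, b}"
    then obtain u v where x: "x = u *\<^sub>R a + v *\<^sub>R b" "u + v = 1" by (auto simp: affine_hull_2)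
    have "l x = u * l a + v * l b + (1 - (u + v)) * d"
      unfolding l(1) x(1) by (simp only: inner_add_right inner_scaleR_right) (simp add: algebra_simps)
    then show "x \<in> {x. l x = 0}" using l x by simp
  qed
  show "{x. l x = 0} \<subseteq> affine hull {a, b}"
  proof
    fix x assume "x \<in> {x. l x = 0}"
    then have "g \<bullet> (x - a) = 0" "g \<bullet> (b - a) = 0" using l by (auto simp: inner_diff_right)
    then obtain c where "x - a = c *\<^sub>R (b - a)"
      using multiple_if_det_0[OF det_0_if_common_normal[OF l(2)], of "x - a" "b - a"] l(5) by auto
    then have "x = (1 - c) *\<^sub>R a + c *\<^sub>R b" by (simp add: algebra_simps)
    then show "x \<in> affine hull {a, b}" unfolding affine_hull_2
      by (intro CollectI exI[of _ "1 - c"] exI[of _ c]) simp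
  qed
qed

lemma affine_coords_change:
  assumes c: "affine_coords l m" and t: "t \<in> polys 1" and z: "z \<in> polys 1"
    and l: "\<And>x. l x = a + b * t x + c * z x" and m: "\<And>x. m x = a' + b' * t x + c' * z x"
  shows "affine_coords t z"
  unfolding affine_coords_def
proof (intro conjI ballI t z)
  fix f assume "f \<in> polys 1"
  then obtain A B C where "f = (\<lambda>x. A + B * l x + C * m x)"
    using c by (auto simp: affine_coords_def)
  then have "f = (\<lambda>x. (A + B * a + C * a') + (B * b + C * b') * t x + (B * c + C * c') * z x)"
    by (auto simp: l m algebra_simps)
  then show "\<exists>A B C. f = (\<lambda>x. A + B * t x + C * z x)" by blast
qed

text \<open>
  For parallel edges the unit gradients are opposite, because each function is positive on the
  other edge; hence \<open>l + l'\<close> is a positive constant. The zero line of \<open>lH\<close> contains a point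
  of each of the two lines, so \<open>l\<close> is not constant on it and \<open>l\<close>, \<open>lH\<close> are coordinates. For
  nonparallel edges \<open>l\<close>, \<open>l'\<close> are coordinates. In both cases \<open>lH\<close> and the auxiliary
  function arise from these coordinates by an invertible affine change.
\<close>
lemma edge_pair_frame_admissible:
  fixes a b a' b' g g' :: "real ^ 2"
  assumes e: "e = closed_segment a b" "e' = closed_segment a' b'"
    and l: "l = (\<lambda>x. g \<bullet> x + d)" "norm g = 1" "l a = 0" "l b = 0"
    and l': "l' = (\<lambda>x. g' \<bullet> x + d')" "norm g' = 1" "l' a' = 0" "l' b' = 0"
    and pos: "l a' > 0" "l' a > 0" and ne: "a \<noteq> b" "a' \<noteq> b'"
    and adm: "admissible_linear e e' l l' \<alpha> \<beta> \<gamma> lH"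
    and \<eta>: "\<eta> > 0" and \<xi>: "\<xi> > 0"
  shows "edge_pair_frame l l' lH (aux_linear e e' l l' \<alpha> \<beta> \<eta> \<xi>) \<eta> \<xi>"
proof -
  have lp: "l \<in> polys 1" "l' \<in> polys 1" unfolding l(1) l'(1) by (rule affine_in_polys)+
  have g0: "g \<noteq> 0" "g' \<noteq> 0" using l(2) l'(2) by auto
  have hull: "affine hull e = {x. l x = 0}" "affine hull e' = {x. l' x = 0}"
    unfolding e segment_convex_hull affine_hull_convex_hull
    using affine_hull_2_eq_zero_set[OF l(1) g0(1) l(3,4) ne(1)]
      affine_hull_2_eq_zero_set[OF l'(1) g0(2) l'(3,4) ne(2)] by auto
  have sum_pos: "\<xi> + \<eta> > 0" using \<eta> \<xi> by simp
  obtain h k where lH: "h \<noteq> 0" "lH = (\<lambda>x. h \<bullet> x + k)"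
    using adm by (auto simp: admissible_linear_def linear_poly_def)
  then have lHp: "lH \<in> polys 1" by (simp add: affine_in_polys)
  show ?thesis
  proof (cases "parallel_edges e e'")
    case True
    then obtain v where "affine hull e' = (+) v ` (affine hull e)"
      by (auto simp: parallel_edges_def affine_parallel_def)
    then have "l' (v + a) = 0" "l' (v + b) = 0" using l(3,4) unfolding hull by auto
    then have "g' \<bullet> (b - a) = 0" "g \<bullet> (b - a) = 0"
      using l by (auto simp: l'(1) inner_diff_right inner_add_right)
    then have "g' $ 1 * g $ 2 - g' $ 2 * g $ 1 = 0"
      using det_0_if_common_normal[of "b - a" g' g] ne by (simp add: inner_commute)
    then obtain c where c: "g' = c *\<^sub>R g" using multiple_if_det_0 g0 by blast
    then have "\<bar>c\<bar> = 1" using l(2) l'(2) by simp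
    moreover have "c \<noteq> 1"
    proof
      assume "c = 1"
      then have "l a' + l' a = l a + l' a'" by (simp add: l(1) l'(1) c)
      then show False using pos l l' by simp
    qed
    ultimately have c1: "c = - 1" by linarith
    define \<delta> where "\<delta> = d + d'"
    have sum: "l x + l' x = \<delta>" for x by (simp add: l(1) l'(1) c c1 \<delta>_def)
    have \<delta>: "\<delta> \<noteq> 0" using sum[of a] l(3) pos by simp
    obtain p p' where p: "lH p = 0" "l p = 0" "lH p' = 0" "l' p' = 0"
      using adm True hull unfolding admissible_linear_def by auto
    then have "l p' \<noteq> l p" using sum[of p'] \<delta> by auto
    moreover have "lH (p + h) \<noteq> lH p" using lH by (simp add: inner_add_right)
    ultimately have "affine_coords l lH"
      using affine_coordsI[OF lp(1) lHp, of p' p "p + h"] p by simp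
    moreover define z where "z = aux_linear e e' l l' \<alpha> \<beta> \<eta> \<xi>"
    have z: "z = (\<lambda>x. \<xi> * l x - \<eta> * l' x)" using True by (simp add: z_def aux_linear_def)
    have zp: "z \<in> polys 1" unfolding z diff_conv_add_uminus minus_mult_left
      by (intro polys_add polys_scale lp)
    have "l x = \<eta> * \<delta> / (\<xi> + \<eta>) + 0 * lH x + (1 / (\<xi> + \<eta>)) * z x" for x
    proof -
      have "z x + \<eta> * \<delta> = (\<xi> + \<eta>) * l x" unfolding z sum[of x, symmetric] by (simp add: algebra_simps)
      then have "l x = (\<eta> * \<delta> + z x) / (\<xi> + \<eta>)" using sum_pos by (simp add: field_simps)
      then show ?thesis by (simp add: add_divide_distrib)
    qed
    moreover have "lH x = 0 + 1 * lH x + 0 * z x" for x by simp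
    ultimately have "affine_coords lH z" using lHp zp affine_coords_change by blast
    moreover have "\<exists>a b c e. e \<noteq> 0 \<and> (\<forall>x. a * l x + b * l' x = c * lH x + e \<and>
        z x = \<xi> * (a * l x) - \<eta> * (b * l' x))"
      by (intro exI[of _ 1] exI[of _ 0] exI[of _ \<delta>]) (auto simp: sum z \<delta>)
    ultimately show ?thesis unfolding edge_pair_frame_def z_def using lp \<eta> \<xi> by blast
  next
    case False
    have ab: "\<alpha> > 0" "\<beta> > 0" "\<gamma> \<noteq> 0" and lHeq: "lH = (\<lambda>x. \<alpha> * l x + \<beta> * l' x + \<gamma>)"
      using adm False by (auto simp: admissible_linear_def)
    have "g $ 1 * g' $ 2 - g $ 2 * g' $ 1 \<noteq> 0"
    proof
      assume "g $ 1 * g' $ 2 - g $ 2 * g' $ 1 = 0"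
      then obtain c where c: "g = c *\<^sub>R g'" using multiple_if_det_0 g0 by blast
      then have c0: "c \<noteq> 0" using g0 by auto
      have "{x. l' x = 0} = (+) (a' - a) ` {x. l x = 0}"
      proof -
        have shift: "l x = c * l' ((a' - a) + x)" for x
        proof -
          have "l x = l x - l a" using l(3) by simp
          also have "\<dots> = c * (g' \<bullet> (x - a))" by (simp add: l(1) c inner_diff_right right_diff_distrib)
          also have "\<dots> = c * (l' ((a' - a) + x) - l' a')"
            by (simp add: l'(1) inner_diff_right inner_add_right)
          finally show ?thesis using l'(3) by simp
        qed
        show ?thesis
        proof (intro equalityI subsetI)
          fix y assume "y \<in> {x. l' x = 0}"
          then have "y - (a' - a) \<in> {x. l x = 0}" using shift[of "y - (a' - a)"] by simp
          then show "y \<in> (+) (a' - a) ` {x. l x = 0}" by (rule rev_image_eqI) simp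
        next
          fix y assume "y \<in> (+) (a' - a) ` {x. l x = 0}"
          then show "y \<in> {x. l' x = 0}" using shift c0 by auto
        qed
      qed
      then show False using False by (auto simp: parallel_edges_def affine_parallel_def hull)
    qed
    then have "affine_coords l l'" unfolding l(1) l'(1) by (rule affine_coords_det)
    moreover define z where "z = aux_linear e e' l l' \<alpha> \<beta> \<eta> \<xi>"
    have z: "z = (\<lambda>x. \<alpha> * \<xi> * l x - \<beta> * \<eta> * l' x)" using False by (simp add: z_def aux_linear_def)
    have zp: "z \<in> polys 1" unfolding z diff_conv_add_uminus minus_mult_left
      by (intro polys_add polys_scale lp)
    have "l x = - (\<eta> * \<gamma>) / ((\<xi> + \<eta>) * \<alpha>) + \<eta> / ((\<xi> + \<eta>) * \<alpha>) * lH x + (1 / ((\<xi> + \<eta>) * \<alpha>)) * z x" for x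
    proof -
      have "- (\<eta> * \<gamma>) + \<eta> * lH x + z x = ((\<xi> + \<eta>) * \<alpha>) * l x"
        unfolding z lHeq by (simp add: algebra_simps)
      moreover have "(\<xi> + \<eta>) * \<alpha> \<noteq> 0" using sum_pos ab by simp
      ultimately show ?thesis
        by (metis (no_types, lifting) add_divide_distrib nonzero_mult_div_cancel_left
            mult_1 times_divide_eq_left)
    qed
    moreover have "l' x = - (\<xi> * \<gamma>) / ((\<xi> + \<eta>) * \<beta>) + \<xi> / ((\<xi> + \<eta>) * \<beta>) * lH x + (- 1 / ((\<xi> + \<eta>) * \<beta>)) * z x" for x
    proof -
      have "- (\<xi> * \<gamma>) + \<xi> * lH x + (- 1) * z x = ((\<xi> + \<eta>) * \<beta>) * l' x"
        unfolding z lHeq by (simp add: algebra_simps)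
      moreover have "(\<xi> + \<eta>) * \<beta> \<noteq> 0" using sum_pos ab by simp
      ultimately show ?thesis
        by (metis (no_types, lifting) add_divide_distrib nonzero_mult_div_cancel_left
            times_divide_eq_left)
    qed
    ultimately have "affine_coords lH z" using lHp zp affine_coords_change by blast
    moreover have "\<exists>a b c e. e \<noteq> 0 \<and> (\<forall>x. a * l x + b * l' x = c * lH x + e \<and>
        z x = \<xi> * (a * l x) - \<eta> * (b * l' x))"
      by (intro exI[of _ \<alpha>] exI[of _ \<beta>] exI[of _ 1] exI[of _ "- \<gamma>"]) (auto simp: z lHeq ab)
    ultimately show ?thesis unfolding edge_pair_frame_def z_def using lp \<eta> \<xi> by blast
  qed
qed

section \<open>Spans of the shape functions\<close>

lemma restrict_fun_add: "restrict_fun E (\<lambda>x. f x + g x) = (\<lambda>x. restrict_fun E f x + restrict_fun E g x)"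
  by (auto simp: restrict_fun_def)

lemma restrict_fun_scale: "restrict_fun E (\<lambda>x. c * f x) = (\<lambda>x. c * restrict_fun E f x)"
  by (auto simp: restrict_fun_def)

lemma restrict_fun_plus: "restrict_fun E (f + g) = restrict_fun E f + restrict_fun E g"
  by (auto simp: restrict_fun_def plus_fun_def)

lemma restrict_fun_zero: "restrict_fun E (\<lambda>x. 0) = (\<lambda>x. 0)"
  by (auto simp: restrict_fun_def)

lemma subspace_restrict_image:
  assumes "fun_subspace S"
  shows "fun_subspace (restrict_fun E ` S)"
proof (rule fun_subspaceI)
  have add: "(\<lambda>x. f x + g x) \<in> S" if "f \<in> S" "g \<in> S" for f g
    using fun_space.subspace_add[OF assms that] by (simp add: plus_fun_def)
  have scale: "(\<lambda>x. c * f x) \<in> S" if "f \<in> S" for c f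
    using fun_space.subspace_scale[OF assms that] .
  show "(\<lambda>x. 0) \<in> restrict_fun E ` S"
    using fun_space.subspace_0[OF assms]
    by (intro image_eqI[of _ _ "\<lambda>x. 0"]) (simp_all add: restrict_fun_zero zero_fun_def)
  show "(\<lambda>x. f x + g x) \<in> restrict_fun E ` S"
    if "f \<in> restrict_fun E ` S" "g \<in> restrict_fun E ` S" for f g
    using that add by (auto simp flip: restrict_fun_add)
  show "(\<lambda>x. c * f x) \<in> restrict_fun E ` S" if "f \<in> restrict_fun E ` S" for c f
    using that scale by (auto simp flip: restrict_fun_scale)
qed

lemma span_restrict_image: "fun_span (restrict_fun E ` S) = restrict_fun E ` fun_span S"
proof
  show "fun_span (restrict_fun E ` S) \<subseteq> restrict_fun E ` fun_span S"
    by (intro fun_space.span_minimal subspace_restrict_image fun_space.subspace_span image_mono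
        fun_space.span_superset)
  have "fun_span S \<subseteq> {f. restrict_fun E f \<in> fun_span (restrict_fun E ` S)}"
  proof (rule fun_space.span_minimal)
    show "fun_subspace {f. restrict_fun E f \<in> fun_span (restrict_fun E ` S)}"
      by (rule fun_subspaceI)
        (auto simp: restrict_fun_zero restrict_fun_add restrict_fun_scale
          intro: fun_span_zero fun_span_add fun_span_scale)
  qed (auto intro: fun_space.span_base)
  then show "restrict_fun E ` fun_span S \<subseteq> fun_span (restrict_fun E ` S)" by auto
qed

text \<open>
  The polynomial edge functions, that is, all edge functions of a pair except the one that
  contains \<open>R\<close>.
\<close>
definition edge_poly_funs where
  "edge_poly_funs r la lb t z =
     {\<lambda>x::real^2. la x * lb x * t x ^ j :: real | j. j + 2 \<le> r} \<union>
     {\<lambda>x. la x * lb x * z x * t x ^ j | j. j + 3 \<le> r}"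

lemma edge_poly_in_span:
  assumes C: "C \<in> deg_less (r - 1)" and D: "D \<in> deg_less (r - 2)"
  shows "(\<lambda>x. la x * lb x * (poly C (t x) + z x * poly D (t x))) \<in> fun_span (edge_poly_funs r la lb t z)"
proof -
  let ?S = "fun_span (edge_poly_funs r la lb t z)"
  have sum: "(\<lambda>x. \<Sum>j<n. c j * f j x) \<in> ?S" if "\<And>j. j < n \<Longrightarrow> f j \<in> ?S" for n :: nat and c f
    using that
  proof (induction n)
    case (Suc n)
    have "(\<lambda>x. (\<Sum>j<n. c j * f j x) + c n * f n x) \<in> ?S"
      by (intro fun_span_add fun_span_scale Suc) simp_all
    then show ?case by simp
  qed (simp add: fun_span_zero)
  have 1: "(\<lambda>x. \<Sum>j<r - 1. coeff C j * (la x * lb x * t x ^ j)) \<in> ?S"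
    by (rule sum, rule fun_space.span_base) (auto simp: edge_poly_funs_def)
  have 2: "(\<lambda>x. \<Sum>j<r - 2. coeff D j * (la x * lb x * z x * t x ^ j)) \<in> ?S"
    by (rule sum, rule fun_space.span_base, unfold edge_poly_funs_def, rule UnI2) force
  have "(\<lambda>x. la x * lb x * (poly C (t x) + z x * poly D (t x))) =
    (\<lambda>x. (\<Sum>j<r - 1. coeff C j * (la x * lb x * t x ^ j)) +
      (\<Sum>j<r - 2. coeff D j * (la x * lb x * z x * t x ^ j)))"
    by (rule ext) (simp add: poly_deg_less_sum[OF C] poly_deg_less_sum[OF D] sum_distrib_left
        distrib_left mult_ac)
  then show ?thesis using fun_span_add[OF 1 2] by simp
qed

lemma edge_poly_span_form:
  assumes "f \<in> fun_span (edge_poly_funs r la lb t z)"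
  shows "\<exists>C D. C \<in> deg_less (r - 1) \<and> D \<in> deg_less (r - 2) \<and>
    f = (\<lambda>x. la x * lb x * (poly C (t x) + z x * poly D (t x)))"
proof -
  let ?S = "{\<lambda>x. la x * lb x * (poly C (t x) + z x * poly D (t x)) | C D.
    C \<in> deg_less (r - 1) \<and> D \<in> deg_less (r - 2)}"
  have SI: "g \<in> ?S" if "C \<in> deg_less (r - 1)" "D \<in> deg_less (r - 2)"
    "\<And>x. g x = la x * lb x * (poly C (t x) + z x * poly D (t x))" for g C D
    using that by blast
  have "fun_span (edge_poly_funs r la lb t z) \<subseteq> ?S"
  proof (rule fun_space.span_minimal)
    show "edge_poly_funs r la lb t z \<subseteq> ?S"
    proof
      fix g assume "g \<in> edge_poly_funs r la lb t z"
      then consider j where "j + 2 \<le> r" "g = (\<lambda>x. la x * lb x * t x ^ j)"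
        | j where "j + 3 \<le> r" "g = (\<lambda>x. la x * lb x * z x * t x ^ j)"
        by (auto simp: edge_poly_funs_def)
      then show "g \<in> ?S"
      proof cases
        case 1
        then show ?thesis
          by (intro SI[of "monom 1 j" 0]) (auto intro!: deg_less_monom simp: poly_monom)
      next
        case 2
        then show ?thesis
          by (intro SI[of 0 "monom 1 j"]) (auto intro!: deg_less_monom simp: poly_monom)
      qed
    qed
    show "fun_subspace ?S"
    proof (rule fun_subspaceI)
      show "(\<lambda>x. 0) \<in> ?S" by (rule SI[of 0 0]) auto
    next
      fix f g assume "f \<in> ?S" "g \<in> ?S"
      then obtain C D C' D' where
        *: "f = (\<lambda>x. la x * lb x * (poly C (t x) + z x * poly D (t x)))"
           "g = (\<lambda>x. la x * lb x * (poly C' (t x) + z x * poly D' (t x)))"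
        "C \<in> deg_less (r - 1)" "C' \<in> deg_less (r - 1)" "D \<in> deg_less (r - 2)" "D' \<in> deg_less (r - 2)"
        by blast
      show "(\<lambda>x. f x + g x) \<in> ?S"
        by (rule SI[OF deg_less_add[OF *(3,4)] deg_less_add[OF *(5,6)]]) (simp add: * algebra_simps)
    next
      fix c f assume "f \<in> ?S"
      then obtain C D where
        *: "f = (\<lambda>x. la x * lb x * (poly C (t x) + z x * poly D (t x)))"
        "C \<in> deg_less (r - 1)" "D \<in> deg_less (r - 2)"
        by blast
      show "(\<lambda>x. c * f x) \<in> ?S"
        by (rule SI[OF deg_less_smult[OF *(2)] deg_less_smult[OF *(3)]]) (simp add: * algebra_simps)
    qed
  qed
  then show ?thesis using assms by blast
qed

lemma vertex_span_form:
  assumes "f \<in> fun_span (vertex_funs l1 l2 l3 l4)"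
  shows "\<exists>a b c d. f = (\<lambda>x. a * (l2 x * l4 x) + b * (l2 x * l3 x) + c * (l1 x * l4 x) + d * (l1 x * l3 x))"
proof -
  let ?F = "\<lambda>a b c d x. a * (l2 x * l4 x) + b * (l2 x * l3 x) + c * (l1 x * l4 x) + d * (l1 x * l3 x)"
  let ?S = "{f. \<exists>a b c d. f = ?F a b c d}"
  have "fun_span (vertex_funs l1 l2 l3 l4) \<subseteq> ?S"
  proof (rule fun_space.span_minimal)
    have "(\<lambda>x. l2 x * l4 x) = ?F 1 0 0 0" "(\<lambda>x. l2 x * l3 x) = ?F 0 1 0 0"
      "(\<lambda>x. l1 x * l4 x) = ?F 0 0 1 0" "(\<lambda>x. l1 x * l3 x) = ?F 0 0 0 1" by auto
    then show "vertex_funs l1 l2 l3 l4 \<subseteq> ?S" unfolding vertex_funs_def by blast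
    show "fun_subspace ?S"
    proof (rule fun_subspaceI)
      have "(\<lambda>x. 0) = ?F 0 0 0 0" by auto
      then show "(\<lambda>x. 0) \<in> ?S" by blast
    next
      fix f g assume "f \<in> ?S" "g \<in> ?S"
      then obtain a b c d a' b' c' d' where "f = ?F a b c d" "g = ?F a' b' c' d'" by blast
      then have "(\<lambda>x. f x + g x) = ?F (a + a') (b + b') (c + c') (d + d')"
        by (auto simp: algebra_simps)
      then show "(\<lambda>x. f x + g x) \<in> ?S" by blast
    next
      fix k f assume "f \<in> ?S"
      then obtain a b c d where "f = ?F a b c d" by blast
      then have "(\<lambda>x. k * f x) = ?F (k * a) (k * b) (k * c) (k * d)" by (auto simp: algebra_simps)
      then show "(\<lambda>x. k * f x) \<in> ?S" by blast
    qed
  qed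
  then show ?thesis using assms by blast
qed

lemma cell_span_form:
  assumes "f \<in> fun_span (cell_funs r l1 l2 l3 l4)"
  shows "\<exists>p. p \<in> polys (int r - 4) \<and> f = (\<lambda>x. l1 x * l2 x * l3 x * l4 x * p x)"
proof -
  have "fun_subspace (cell_funs r l1 l2 l3 l4)"
  proof (rule fun_subspaceI)
    show "(\<lambda>x. 0) \<in> cell_funs r l1 l2 l3 l4"
      unfolding cell_funs_def by (rule CollectI, rule exI[of _ "\<lambda>x. 0"]) (simp add: polys_zero)
  next
    fix f g assume "f \<in> cell_funs r l1 l2 l3 l4" "g \<in> cell_funs r l1 l2 l3 l4"
    then obtain p q where "f = (\<lambda>x. l1 x * l2 x * l3 x * l4 x * p x)" "p \<in> polys (int r - 4)"
      "g = (\<lambda>x. l1 x * l2 x * l3 x * l4 x * q x)" "q \<in> polys (int r - 4)"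
      unfolding cell_funs_def by blast
    then show "(\<lambda>x. f x + g x) \<in> cell_funs r l1 l2 l3 l4"
      unfolding cell_funs_def
      by (intro CollectI exI[of _ "\<lambda>x. p x + q x"]) (simp add: polys_add distrib_left)
  next
    fix c f assume "f \<in> cell_funs r l1 l2 l3 l4"
    then obtain p where "f = (\<lambda>x. l1 x * l2 x * l3 x * l4 x * p x)" "p \<in> polys (int r - 4)"
      unfolding cell_funs_def by blast
    then show "(\<lambda>x. c * f x) \<in> cell_funs r l1 l2 l3 l4"
      unfolding cell_funs_def
      by (intro CollectI exI[of _ "\<lambda>x. c * p x"]) (simp add: polys_scale mult_ac)
  qed
  then have "fun_span (cell_funs r l1 l2 l3 l4) \<subseteq> cell_funs r l1 l2 l3 l4"
    by (intro fun_space.span_minimal) auto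
  then show ?thesis using assms unfolding cell_funs_def by blast
qed

lemma span_pair_form:
  assumes "f \<in> fun_span {g, h}"
  shows "\<exists>a b. f = (\<lambda>x. a * g x + b * h x)"
proof -
  let ?S = "{f. \<exists>a b. f = (\<lambda>x. a * g x + b * h x)}"
  have "fun_span {g, h} \<subseteq> ?S"
  proof (rule fun_space.span_minimal)
    have "g = (\<lambda>x. 1 * g x + 0 * h x)" "h = (\<lambda>x. 0 * g x + 1 * h x)" by auto
    then show "{g, h} \<subseteq> ?S" by blast
    show "fun_subspace ?S"
    proof (rule fun_subspaceI)
      have "(\<lambda>x. 0) = (\<lambda>x. 0 * g x + 0 * h x)" by auto
      then show "(\<lambda>x. 0) \<in> ?S" by blast
    next
      fix f f' assume "f \<in> ?S" "f' \<in> ?S"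
      then obtain a b a' b' where "f = (\<lambda>x. a * g x + b * h x)" "f' = (\<lambda>x. a' * g x + b' * h x)"
        by blast
      then have "(\<lambda>x. f x + f' x) = (\<lambda>x. (a + a') * g x + (b + b') * h x)"
        by (auto simp: algebra_simps)
      then show "(\<lambda>x. f x + f' x) \<in> ?S" by blast
    next
      fix k f assume "f \<in> ?S"
      then obtain a b where "f = (\<lambda>x. a * g x + b * h x)" by blast
      then have "(\<lambda>x. k * f x) = (\<lambda>x. (k * a) * g x + (k * b) * h x)" by (auto simp: algebra_simps)
      then show "(\<lambda>x. k * f x) \<in> ?S" by blast
    qed
  qed
  then show ?thesis using assms by blast
qed

lemma polys_power: "t \<in> polys 1 \<Longrightarrow> (\<lambda>x. t x ^ j) \<in> polys (int j)"
proof (induction j)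
  case (Suc j)
  from polys_mult[OF Suc.prems Suc.IH[OF Suc.prems]] show ?case by simp
qed (simp add: polys_const)

lemma edge_poly_funs_in_polys:
  assumes "la \<in> polys 1" "lb \<in> polys 1" "t \<in> polys 1" "z \<in> polys 1"
  shows "edge_poly_funs r la lb t z \<subseteq> polys (int r)"
proof -
  have "(\<lambda>x. la x * lb x * t x ^ j) \<in> polys (int r)" if "j + 2 \<le> r" for j
    using polys_mult[OF polys_mult[OF assms(1,2)] polys_power[OF assms(3), of j]]
      polys_mono[of "1 + 1 + int j" "int r"] that by auto
  moreover have "(\<lambda>x. la x * lb x * z x * t x ^ j) \<in> polys (int r)" if "j + 3 \<le> r" for j
    using polys_mult[OF polys_mult[OF polys_mult[OF assms(1,2)] assms(4)] polys_power[OF assms(3), of j]]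
      polys_mono[of "1 + 1 + 1 + int j" "int r"] that by auto
  ultimately show ?thesis by (auto simp: edge_poly_funs_def)
qed

text \<open>
  The inner nodes of the segment, with its end points given in a fixed order.
\<close>
definition edge_points :: "nat \<Rightarrow> real ^ 2 \<Rightarrow> real ^ 2 \<Rightarrow> (real ^ 2) set" where
  "edge_points r a b = (\<lambda>j. (1 - real j / real r) *\<^sub>R a + (real j / real r) *\<^sub>R b) ` {0<..<r}"

lemma finite_edge_points: "finite (edge_points r a b)"
  by (simp add: edge_points_def)

lemma card_edge_points:
  assumes "a \<noteq> b"
  shows "card (edge_points r a b) = r - 1"
proof -
  have "inj_on (\<lambda>j. (1 - real j / real r) *\<^sub>R a + (real j / real r) *\<^sub>R b) {0<..<r}"
  proof (rule inj_onI)
    fix i j assume r: "i \<in> {0<..<r}" "j \<in> {0<..<r}" and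
      eq: "(1 - real i / real r) *\<^sub>R a + (real i / real r) *\<^sub>R b =
      (1 - real j / real r) *\<^sub>R a + (real j / real r) *\<^sub>R b"
    then have "(real i / real r - real j / real r) *\<^sub>R (b - a) = 0" by (simp add: algebra_simps)
    then show "i = j" using assms r by auto
  qed
  then show ?thesis by (simp add: edge_points_def card_image)
qed

lemma polys_1_convex_combination:
  assumes "l \<in> polys 1"
  shows "l ((1 - s) *\<^sub>R a + s *\<^sub>R b) = (1 - s) * l a + s * l b"
proof -
  obtain g d where "l = (\<lambda>x. g \<bullet> x + d)" using polys_1_affine[OF assms] by blast
  then show ?thesis by (simp add: inner_add_right algebra_simps)
qed

lemma edge_points_zero:
  assumes "l \<in> polys 1" "l a = 0" "l b = 0" "x \<in> edge_points r a b"
  shows "l x = 0"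
  using assms by (auto simp: edge_points_def polys_1_convex_combination)

lemma edge_points_pos:
  assumes "l \<in> polys 1" "l a \<ge> 0" "l b \<ge> 0" "l a > 0 \<or> l b > 0" "x \<in> edge_points r a b"
  shows "l x > 0"
proof -
  obtain j where j: "0 < j" "j < r" and x: "x = (1 - real j / real r) *\<^sub>R a + (real j / real r) *\<^sub>R b"
    using assms(5) by (auto simp: edge_points_def)
  define s where "s = real j / real r"
  have s: "0 < s" "s < 1" using j by (auto simp: s_def)
  have "(1 - s) * l a + s * l b > 0"
    using assms(2-4) s by (auto intro: add_pos_nonneg add_nonneg_pos)
  then show ?thesis using x polys_1_convex_combination[OF assms(1)] by (simp add: s_def)
qed

lemma edge_points_in_segment: "edge_points r a b \<subseteq> closed_segment a b"
proof
  fix x assume "x \<in> edge_points r a b"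
  then obtain j where j: "0 < j" "j < r" and x: "x = (1 - real j / real r) *\<^sub>R a + (real j / real r) *\<^sub>R b"
    by (auto simp: edge_points_def)
  show "x \<in> closed_segment a b" unfolding in_segment
    by (rule exI[of _ "real j / real r"]) (use j x in auto)
qed

lemma edge_points_in_edge_nodes: "edge_points r a b \<subseteq> edge_nodes r (closed_segment a b)"
proof
  fix x assume "x \<in> edge_points r a b"
  then obtain j where "0 < j" "j < r" "x = (1 - real j / real r) *\<^sub>R a + (real j / real r) *\<^sub>R b"
    by (auto simp: edge_points_def)
  then show "x \<in> edge_nodes r (closed_segment a b)" unfolding edge_nodes_def by blast
qed

section \<open>Unisolvence and the direct decomposition\<close>

text \<open>
  The situation of the theorem after the geometry has been absorbed into the two frames.
\<close>
locale direct_serendipity = quadrilateral_functions +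
  fixes r :: nat and lH lV l12 l34 RV RH :: "real ^ 2 \<Rightarrow> real" and \<eta>V \<xi>V \<eta>H \<xi>H :: real
  assumes r: "r \<ge> 2"
    and frame_H: "edge_pair_frame l1 l2 lH l12 \<eta>V \<xi>V"
    and frame_V: "edge_pair_frame l3 l4 lV l34 \<eta>H \<xi>H"
    and RV: "\<And>x. x \<in> closed_segment v13 v14 \<Longrightarrow> RV x = - \<eta>V"
      "\<And>x. x \<in> closed_segment v23 v24 \<Longrightarrow> RV x = \<xi>V"
    and RH: "\<And>x. x \<in> closed_segment v13 v23 \<Longrightarrow> RH x = - \<eta>H"
      "\<And>x. x \<in> closed_segment v14 v24 \<Longrightarrow> RH x = \<xi>H"
begin

definition poly_shape_funs :: "(real ^ 2 \<Rightarrow> real) set" where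
  "poly_shape_funs = vertex_funs l1 l2 l3 l4 \<union> edge_poly_funs r l3 l4 lH l12 \<union>
     edge_poly_funs r l1 l2 lV l34 \<union> cell_funs r l1 l2 l3 l4"

definition supplement_funs :: "(real ^ 2 \<Rightarrow> real) set" where
  "supplement_funs = {\<lambda>x. l3 x * l4 x * lH x ^ (r - 2) * RV x, \<lambda>x. l1 x * l2 x * lV x ^ (r - 2) * RH x}"

lemma shape_funs_eq:
  "vertex_funs l1 l2 l3 l4 \<union> edge_funs r l3 l4 lH l12 RV \<union> edge_funs r l1 l2 lV l34 RH \<union>
     cell_funs r l1 l2 l3 l4 = poly_shape_funs \<union> supplement_funs"
proof -
  have "(\<lambda>x. l3 x * l4 x * RV x * lH x ^ (r - 2)) = (\<lambda>x. l3 x * l4 x * lH x ^ (r - 2) * RV x)"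
    "(\<lambda>x. l1 x * l2 x * RH x * lV x ^ (r - 2)) = (\<lambda>x. l1 x * l2 x * lV x ^ (r - 2) * RH x)"
    by (simp_all add: mult_ac)
  then have "edge_funs r l3 l4 lH l12 RV = edge_poly_funs r l3 l4 lH l12 \<union>
      {\<lambda>x. l3 x * l4 x * lH x ^ (r - 2) * RV x}"
    "edge_funs r l1 l2 lV l34 RH = edge_poly_funs r l1 l2 lV l34 \<union>
      {\<lambda>x. l1 x * l2 x * lV x ^ (r - 2) * RH x}"
    unfolding edge_funs_def edge_poly_funs_def by simp_all
  then show ?thesis unfolding poly_shape_funs_def supplement_funs_def by auto
qed

lemma frame_affine: "lH \<in> polys 1" "l12 \<in> polys 1" "lV \<in> polys 1" "l34 \<in> polys 1"
  using frame_H frame_V by (auto simp: edge_pair_frame_def affine_coords_def)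

text \<open>
  Every polynomial is split into vertex functions and multiples of \<open>l1 l2\<close> and of \<open>l3 l4\<close>; the
  cofactor of \<open>l1 l2\<close> is then split along the pair \<open>l3\<close>, \<open>l4\<close> and vice versa. What is
  left over is a multiple of \<open>l1 l2 l3 l4\<close>, that is, a cell function.
\<close>
lemma span_poly_shape_funs: "fun_span poly_shape_funs = polys (int r)"
proof
  have "vertex_funs l1 l2 l3 l4 \<subseteq> polys (1 + 1)"
    unfolding vertex_funs_def by (intro insert_subsetI empty_subsetI polys_mult affine)
  also have "\<dots> \<subseteq> polys (int r)" by (rule polys_mono) (use r in simp)
  finally have v: "vertex_funs l1 l2 l3 l4 \<subseteq> polys (int r)" .
  have c: "cell_funs r l1 l2 l3 l4 \<subseteq> polys (int r)"
  proof
    fix f assume "f \<in> cell_funs r l1 l2 l3 l4"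
    then obtain p where p: "p \<in> polys (int r - 4)" and f: "f = (\<lambda>x. l1 x * l2 x * l3 x * l4 x * p x)"
      by (auto simp: cell_funs_def)
    have "f \<in> polys (1 + 1 + 1 + 1 + (int r - 4))" unfolding f by (intro polys_mult affine p)
    then show "f \<in> polys (int r)" by simp
  qed
  show "fun_span poly_shape_funs \<subseteq> polys (int r)"
    unfolding poly_shape_funs_def
    by (intro fun_space.span_minimal subspace_polys Un_least v c edge_poly_funs_in_polys affine
        frame_affine)
  have rr: "Suc (r - 2) = r - 1" "int (r - 2) - 2 = int r - 4" using r by auto
  have cell: "(\<lambda>x. l1 x * l2 x * l3 x * l4 x * p x) \<in> fun_span poly_shape_funs"
    if "p \<in> polys (int r - 4)" for p
    by (rule fun_space.span_base) (use that in \<open>auto simp: poly_shape_funs_def cell_funs_def\<close>)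
  have "l \<in> fun_span poly_shape_funs"
    if "l \<in> vertex_funs l1 l2 l3 l4" for l
    by (rule fun_space.span_base) (use that in \<open>auto simp: poly_shape_funs_def\<close>)
  moreover have "(\<lambda>x. l1 x * l2 x * p x) \<in> fun_span poly_shape_funs" if pk: "p \<in> polys (int (r - 2))" for p
  proof -
    obtain C D q where p: "p = (\<lambda>x. poly C (lV x) + l34 x * poly D (lV x) + l3 x * l4 x * q x)"
      and C: "C \<in> deg_less (r - 1)" and D: "D \<in> deg_less (r - 2)" and q: "q \<in> polys (int r - 4)"
      using polys_split_along_edge_pair[OF frame_V, of "r - 2"] pk unfolding rr by blast
    have "(\<lambda>x. l1 x * l2 x * (poly C (lV x) + l34 x * poly D (lV x))) \<in>
        fun_span (edge_poly_funs r l1 l2 lV l34)" by (rule edge_poly_in_span[OF C D])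
    also have "\<dots> \<subseteq> fun_span poly_shape_funs"
      by (rule fun_space.span_mono) (auto simp: poly_shape_funs_def)
    finally have "(\<lambda>x. l1 x * l2 x * (poly C (lV x) + l34 x * poly D (lV x)) +
        l1 x * l2 x * l3 x * l4 x * q x) \<in> fun_span poly_shape_funs"
      by (rule fun_span_add) (rule cell[OF q])
    then show ?thesis by (simp add: p algebra_simps)
  qed
  moreover have "(\<lambda>x. l3 x * l4 x * p x) \<in> fun_span poly_shape_funs" if pk: "p \<in> polys (int (r - 2))" for p
  proof -
    obtain C D q where p: "p = (\<lambda>x. poly C (lH x) + l12 x * poly D (lH x) + l1 x * l2 x * q x)"
      and C: "C \<in> deg_less (r - 1)" and D: "D \<in> deg_less (r - 2)" and q: "q \<in> polys (int r - 4)"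
      using polys_split_along_edge_pair[OF frame_H, of "r - 2"] pk unfolding rr by blast
    have "(\<lambda>x. l3 x * l4 x * (poly C (lH x) + l12 x * poly D (lH x))) \<in>
        fun_span (edge_poly_funs r l3 l4 lH l12)" by (rule edge_poly_in_span[OF C D])
    also have "\<dots> \<subseteq> fun_span poly_shape_funs"
      by (rule fun_space.span_mono) (auto simp: poly_shape_funs_def)
    finally have "(\<lambda>x. l3 x * l4 x * (poly C (lH x) + l12 x * poly D (lH x)) +
        l1 x * l2 x * l3 x * l4 x * q x) \<in> fun_span poly_shape_funs"
      by (rule fun_span_add) (rule cell[OF q])
    then show ?thesis by (simp add: p algebra_simps)
  qed
  ultimately have "split_span (r - 2) \<subseteq> fun_span poly_shape_funs"
    unfolding split_span_def by (intro fun_space.span_minimal fun_space.subspace_span) auto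
  moreover have "Suc (Suc (r - 2)) = r" using r by simp
  ultimately show "polys (int r) \<subseteq> fun_span poly_shape_funs"
    using polys_split_along_quadrilateral[of "r - 2"] by simp
qed

text \<open>
  The coefficients vanish in groups: those of the vertex functions by the values at the vertices,
  where every other shape function is zero; then those of each pair of edges, since on an edge
  only the functions of its own pair survive and the common factor is positive there; finally
  the cell function. The conclusion treats the polynomial part \<open>u\<close> and the supplement part
  \<open>w\<close> separately, so that it also yields directness of the sum.
\<close>
lemma unisolvence:
  assumes u: "u \<in> fun_span poly_shape_funs" and w: "w \<in> fun_span supplement_funs"
    and vertices: "\<And>x. x \<in> {v13, v14, v23, v24} \<Longrightarrow> u x + w x = 0"
    and edges: "\<And>x. x \<in> edge_points r v13 v14 \<union> edge_points r v23 v24 \<union>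
        edge_points r v13 v23 \<union> edge_points r v14 v24 \<Longrightarrow> u x + w x = 0"
    and cell: "\<And>x. x \<in> N \<Longrightarrow> u x + w x = 0"
    and N: "\<And>x. x \<in> N \<Longrightarrow> l1 x \<noteq> 0 \<and> l2 x \<noteq> 0 \<and> l3 x \<noteq> 0 \<and> l4 x \<noteq> 0"
    and N_uni: "\<And>p. p \<in> polys (int r - 4) \<Longrightarrow> (\<And>x. x \<in> N \<Longrightarrow> p x = 0) \<Longrightarrow> p = (\<lambda>x. 0)"
  shows "u = (\<lambda>x. 0) \<and> w = (\<lambda>x. 0)"
proof -
  obtain f1 f2 f3 f4 where u_eq: "u = f1 + f2 + f3 + f4"
    and f: "f1 \<in> fun_span (vertex_funs l1 l2 l3 l4)" "f2 \<in> fun_span (edge_poly_funs r l3 l4 lH l12)"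
      "f3 \<in> fun_span (edge_poly_funs r l1 l2 lV l34)" "f4 \<in> fun_span (cell_funs r l1 l2 l3 l4)"
    using u unfolding poly_shape_funs_def fun_space.span_Un by blast
  obtain a b c d where f1: "f1 = (\<lambda>x. a * (l2 x * l4 x) + b * (l2 x * l3 x) + c * (l1 x * l4 x) + d * (l1 x * l3 x))"
    using vertex_span_form[OF f(1)] by blast
  obtain C D where CD: "C \<in> deg_less (r - 1)" "D \<in> deg_less (r - 2)"
    and f2: "f2 = (\<lambda>x. l3 x * l4 x * (poly C (lH x) + l12 x * poly D (lH x)))"
    using edge_poly_span_form[OF f(2)] by blast
  obtain C' D' where CD': "C' \<in> deg_less (r - 1)" "D' \<in> deg_less (r - 2)"
    and f3: "f3 = (\<lambda>x. l1 x * l2 x * (poly C' (lV x) + l34 x * poly D' (lV x)))"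
    using edge_poly_span_form[OF f(3)] by blast
  obtain p where p: "p \<in> polys (int r - 4)" and f4: "f4 = (\<lambda>x. l1 x * l2 x * l3 x * l4 x * p x)"
    using cell_span_form[OF f(4)] by blast
  obtain \<sigma> \<tau> where w_eq: "w = (\<lambda>x. \<sigma> * (l3 x * l4 x * lH x ^ (r - 2) * RV x) +
      \<tau> * (l1 x * l2 x * lV x ^ (r - 2) * RH x))"
    using span_pair_form[OF w[unfolded supplement_funs_def]] by blast
  have uw: "u x + w x = f1 x +
      l3 x * l4 x * (poly C (lH x) + l12 x * poly D (lH x) + \<sigma> * RV x * lH x ^ (r - 2)) +
      l1 x * l2 x * (poly C' (lV x) + l34 x * poly D' (lV x) + \<tau> * RH x * lV x ^ (r - 2)) +
      l1 x * l2 x * l3 x * l4 x * p x" for x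
    unfolding u_eq w_eq f2 f3 f4 by (simp add: algebra_simps)
  have "a = 0" "b = 0" "c = 0" "d = 0"
    using vertices[of v13] vertices[of v14] vertices[of v23] vertices[of v24] pos
    unfolding uw f1 by (auto simp: zero)
  then have f1_0: "f1 = (\<lambda>x. 0)" by (simp add: f1)
  have ne: "v13 \<noteq> v14" "v23 \<noteq> v24" "v13 \<noteq> v23" "v14 \<noteq> v24" using pos zero by auto
  have segs: "x \<in> closed_segment y z" if "x \<in> edge_points r y z" for x y z
    using that edge_points_in_segment by blast
  have H: "C = 0 \<and> D = 0 \<and> \<sigma> = 0"
  proof (rule edge_coefficients_zero[OF frame_H r CD finite_edge_points _ finite_edge_points])
    show "r - 1 \<le> card (edge_points r v13 v14)" "r - 1 \<le> card (edge_points r v23 v24)"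
      using card_edge_points ne by simp_all
  next
    fix x assume x: "x \<in> edge_points r v13 v14"
    have "l1 x = 0" by (rule edge_points_zero[OF affine(1) zero(1,2) x])
    moreover have "l3 x > 0" "l4 x > 0"
      using edge_points_pos[OF affine(3) _ _ _ x] edge_points_pos[OF affine(4) _ _ _ x] zero pos by auto
    ultimately show "l1 x = 0 \<and> poly C (lH x) + l12 x * poly D (lH x) + \<sigma> * (- \<eta>V) * lH x ^ (r - 2) = 0"
      using edges[of x] x unfolding uw f1_0 RV(1)[OF segs[OF x]] by simp
  next
    fix x assume x: "x \<in> edge_points r v23 v24"
    have "l2 x = 0" by (rule edge_points_zero[OF affine(2) zero(3,4) x])
    moreover have "l3 x > 0" "l4 x > 0"
      using edge_points_pos[OF affine(3) _ _ _ x] edge_points_pos[OF affine(4) _ _ _ x] zero pos by auto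
    ultimately show "l2 x = 0 \<and> poly C (lH x) + l12 x * poly D (lH x) + \<sigma> * \<xi>V * lH x ^ (r - 2) = 0"
      using edges[of x] x unfolding uw f1_0 RV(2)[OF segs[OF x]] by simp
  qed
  have V: "C' = 0 \<and> D' = 0 \<and> \<tau> = 0"
  proof (rule edge_coefficients_zero[OF frame_V r CD' finite_edge_points _ finite_edge_points])
    show "r - 1 \<le> card (edge_points r v13 v23)" "r - 1 \<le> card (edge_points r v14 v24)"
      using card_edge_points ne by simp_all
  next
    fix x assume x: "x \<in> edge_points r v13 v23"
    have "l3 x = 0" by (rule edge_points_zero[OF affine(3) zero(5,6) x])
    moreover have "l1 x > 0" "l2 x > 0"
      using edge_points_pos[OF affine(1) _ _ _ x] edge_points_pos[OF affine(2) _ _ _ x] zero pos by auto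
    ultimately show "l3 x = 0 \<and> poly C' (lV x) + l34 x * poly D' (lV x) + \<tau> * (- \<eta>H) * lV x ^ (r - 2) = 0"
      using edges[of x] x unfolding uw f1_0 RH(1)[OF segs[OF x]] by simp
  next
    fix x assume x: "x \<in> edge_points r v14 v24"
    have "l4 x = 0" by (rule edge_points_zero[OF affine(4) zero(7,8) x])
    moreover have "l1 x > 0" "l2 x > 0"
      using edge_points_pos[OF affine(1) _ _ _ x] edge_points_pos[OF affine(2) _ _ _ x] zero pos by auto
    ultimately show "l4 x = 0 \<and> poly C' (lV x) + l34 x * poly D' (lV x) + \<tau> * \<xi>H * lV x ^ (r - 2) = 0"
      using edges[of x] x unfolding uw f1_0 RH(2)[OF segs[OF x]] by simp
  qed
  have "p = (\<lambda>x. 0)"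
  proof (rule N_uni[OF p])
    fix x assume "x \<in> N"
    then show "p x = 0" using cell[of x] N[of x] unfolding uw f1_0 by (simp add: H V)
  qed
  then show ?thesis using H V
    by (simp add: u_eq f1_0 f2 f3 f4 w_eq plus_fun_def)
qed

end

theorem theorem3p2:
  fixes E e1 e2 e3 e4 :: "(real ^ 2) set"
    and l1 l2 l3 l4 lH lV l12 l34 RV RH :: "real ^ 2 \<Rightarrow> real"
    and \<alpha>H \<beta>H \<gamma>H \<alpha>V \<beta>V \<gamma>V \<eta>V \<xi>V \<eta>H \<xi>H :: real
    and r D :: nat
    and xn :: "nat \<Rightarrow> real ^ 2"
  assumes "convex_quadrilateral E e1 e2 e3 e4"
    and "edge_linear E e1 l1" and "edge_linear E e2 l2"
    and "edge_linear E e3 l3" and "edge_linear E e4 l4"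
    and "r \<ge> 2"
    and "admissible_linear e1 e2 l1 l2 \<alpha>H \<beta>H \<gamma>H lH"
    and "admissible_linear e3 e4 l3 l4 \<alpha>V \<beta>V \<gamma>V lV"
    and "admissible_supplement E e1 e2 \<eta>V \<xi>V RV"
    and "admissible_supplement E e3 e4 \<eta>H \<xi>H RH"
    and "l12 = aux_linear e1 e2 l1 l2 \<alpha>H \<beta>H \<eta>V \<xi>V"
    and "l34 = aux_linear e3 e4 l3 l4 \<alpha>V \<beta>V \<eta>H \<xi>H"
    and "D = (r + 2) * (r + 1) div 2 + 2"
    and "nodal_points E e1 e2 e3 e4 r (xn ` {1..D})"
    and "inj_on xn {1..D}"
  shows "(\<forall>\<phi> \<in> DS E r l1 l2 l3 l4 lH lV l12 l34 RV RH.
            (\<forall>k\<in>{1..D}. \<phi> (xn k) = 0) \<longrightarrow> \<phi> = 0) \<and>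
         direct_sum_of (DS E r l1 l2 l3 l4 lH lV l12 l34 RV RH)
           (polys_on E (int r)) (supplement_space E r l1 l2 l3 l4 lH lV RV RH)"
proof -
  obtain v13 v14 v23 v24 g1 d1 g2 d2 g3 d3 g4 d4 where
    e: "e1 = closed_segment v13 v14" "e2 = closed_segment v23 v24"
      "e3 = closed_segment v13 v23" "e4 = closed_segment v14 v24"
    and ext: "{v. v extreme_point_of E} = {v13, v14, v23, v24}"
    and Q: "quadrilateral_functions v13 v14 v23 v24 l1 l2 l3 l4"
    and l1: "l1 = (\<lambda>x. g1 \<bullet> x + d1)" "norm g1 = 1" "\<And>y. y \<in> E \<Longrightarrow> l1 y \<ge> 0"
    and l2: "l2 = (\<lambda>x. g2 \<bullet> x + d2)" "norm g2 = 1" "\<And>y. y \<in> E \<Longrightarrow> l2 y \<ge> 0"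
    and l3: "l3 = (\<lambda>x. g3 \<bullet> x + d3)" "norm g3 = 1" "\<And>y. y \<in> E \<Longrightarrow> l3 y \<ge> 0"
    and l4: "l4 = (\<lambda>x. g4 \<bullet> x + d4)" "norm g4 = 1" "\<And>y. y \<in> E \<Longrightarrow> l4 y \<ge> 0"
    and sub: "e1 \<subseteq> E" "e2 \<subseteq> E" "e3 \<subseteq> E" "e4 \<subseteq> E"
    by (rule quadrilateral_geometry[OF assms(1-5)]) (rule that)
  interpret quadrilateral_functions v13 v14 v23 v24 l1 l2 l3 l4 by (rule Q)
  have ne: "v13 \<noteq> v14" "v23 \<noteq> v24" "v13 \<noteq> v23" "v14 \<noteq> v24" using pos zero by auto
  have pv: "\<eta>V > 0" "\<xi>V > 0" "\<eta>H > 0" "\<xi>H > 0"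
    using assms(9,10) by (auto simp: admissible_supplement_def)
  have FH: "edge_pair_frame l1 l2 lH l12 \<eta>V \<xi>V" unfolding assms(11)
    by (rule edge_pair_frame_admissible[OF e(1,2) l1(1,2) zero(1,2) l2(1,2) zero(3,4) pos(1,3) ne(1,2)
          assms(7) pv(1,2)])
  have FV: "edge_pair_frame l3 l4 lV l34 \<eta>H \<xi>H" unfolding assms(12)
    by (rule edge_pair_frame_admissible[OF e(3,4) l3(1,2) zero(5,6) l4(1,2) zero(7,8) pos(5,7) ne(3,4)
          assms(8) pv(3,4)])
  interpret direct_serendipity v13 v14 v23 v24 l1 l2 l3 l4 r lH lV l12 l34 RV RH \<eta>V \<xi>V \<eta>H \<xi>H
    by (unfold_locales; (fact assms(6) FH FV)?)
      (use assms(9,10) in \<open>auto simp: admissible_supplement_def e\<close>)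
  obtain N where N: "interior_nodes E r N" and X: "xn ` {1..D} = {v. v extreme_point_of E} \<union>
      (\<Union>e\<in>{e1, e2, e3, e4}. edge_nodes r e) \<union> N"
    using assms(14) unfolding nodal_points_def by blast
  let ?nodes = "{v13, v14, v23, v24} \<union> (edge_points r v13 v14 \<union> edge_points r v23 v24 \<union>
        edge_points r v13 v23 \<union> edge_points r v14 v24) \<union> N"
  have nodes_X: "?nodes \<subseteq> xn ` {1..D}"
  proof -
    have "edge_points r v13 v14 \<subseteq> edge_nodes r e1" "edge_points r v23 v24 \<subseteq> edge_nodes r e2"
      "edge_points r v13 v23 \<subseteq> edge_nodes r e3" "edge_points r v14 v24 \<subseteq> edge_nodes r e4"
      unfolding e by (rule edge_points_in_edge_nodes)+
    then show ?thesis unfolding X ext by auto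
  qed
  have N_int: "N \<subseteq> interior E"
  proof (cases "r < 4")
    case False
    then obtain T where T: "T \<subseteq> interior E" "lagrange_nodes (r - 4) T N"
      using N by (auto simp: interior_nodes_def)
    obtain a b c where Teq: "T = convex hull {a, b, c}" and
      NT: "if r - 4 = 0 then \<exists>p\<in>T. N = {p} else N = {(real i / real (r - 4)) *\<^sub>R a + (real j / real (r - 4)) *\<^sub>R b + (real m / real (r - 4)) *\<^sub>R c
                   | i j m. i + j + m = r - 4}"
      using T(2) unfolding lagrange_nodes_def by blast
    have "N \<subseteq> T"
    proof (cases "r - 4 = 0")
      case True
      then show ?thesis using NT by auto
    next
      case False
      show ?thesis
      proof
        fix x assume "x \<in> N"
        then obtain i j m where x: "x = (real i / real (r - 4)) *\<^sub>R a + (real j / real (r - 4)) *\<^sub>R b +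
            (real m / real (r - 4)) *\<^sub>R c" and s: "i + j + m = r - 4"
          using NT False by auto
        have "real i / real (r - 4) + real j / real (r - 4) + real m / real (r - 4) =
            real (i + j + m) / real (r - 4)" by (simp add: add_divide_distrib)
        also have "\<dots> = 1" using s False by simp
        finally show "x \<in> T" unfolding Teq convex_hull_3 x by fastforce
      qed
    qed
    then show ?thesis using T by blast
  qed (use N in \<open>auto simp: interior_nodes_def\<close>)
  have nodes_E: "?nodes \<subseteq> E"
  proof (intro Un_least)
    show "{v13, v14, v23, v24} \<subseteq> E" using sub(1,2) unfolding e by auto
    show "edge_points r v13 v14 \<subseteq> E" "edge_points r v23 v24 \<subseteq> E"
      "edge_points r v13 v23 \<subseteq> E" "edge_points r v14 v24 \<subseteq> E"
      using sub unfolding e by (blast intro: subsetD[OF edge_points_in_segment])+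
    show "N \<subseteq> E" using N_int interior_subset[of E] by blast
  qed
  have uni: "u = (\<lambda>x. 0) \<and> w = (\<lambda>x. 0)"
    if u: "u \<in> polys (int r)" and w: "w \<in> fun_span supplement_funs"
      and null: "\<And>x. x \<in> ?nodes \<Longrightarrow> u x + w x = 0" for u w
  proof (rule unisolvence[where N = N])
    show "u \<in> fun_span poly_shape_funs" unfolding span_poly_shape_funs by (rule u)
    show "w \<in> fun_span supplement_funs" by (rule w)
    show "u x + w x = 0" if "x \<in> {v13, v14, v23, v24}" for x
      by (rule null, rule UnI1, rule UnI1, rule that)
    show "u x + w x = 0" if "x \<in> edge_points r v13 v14 \<union> edge_points r v23 v24 \<union>
        edge_points r v13 v23 \<union> edge_points r v14 v24" for x
      by (rule null, rule UnI1, rule UnI2, rule that)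
    show "u x + w x = 0" if "x \<in> N" for x
      by (rule null, rule UnI2, rule that)
    fix x assume "x \<in> N"
    then have x: "x \<in> interior E" using N_int by blast
    show "l1 x \<noteq> 0 \<and> l2 x \<noteq> 0 \<and> l3 x \<noteq> 0 \<and> l4 x \<noteq> 0"
      using positive_in_interior[OF l1 x] positive_in_interior[OF l2 x]
        positive_in_interior[OF l3 x] positive_in_interior[OF l4 x] by simp
  next
    fix p assume p: "p \<in> polys (int r - 4)" and z: "\<And>x. x \<in> N \<Longrightarrow> p x = 0"
    show "p = (\<lambda>x. 0)"
    proof (cases "r < 4")
      case True
      then show ?thesis using polys_neg[OF _ p] by simp
    next
      case False
      then obtain T where T: "lagrange_nodes (r - 4) T N"
        using N by (auto simp: interior_nodes_def)
      have "p \<in> polys (int (r - 4))" using p False by (simp add: of_nat_diff)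
      then show ?thesis by (rule polys_zero_on_lagrange_nodes[OF T]) (rule z)
    qed
  qed
  have DS_eq: "DS E r l1 l2 l3 l4 lH lV l12 l34 RV RH =
      {restrict_fun E u + restrict_fun E w | u w. u \<in> polys (int r) \<and> w \<in> fun_span supplement_funs}"
    unfolding DS_def span_restrict_image shape_funs_eq fun_space.span_Un span_poly_shape_funs
  proof (intro equalityI subsetI)
    fix f assume "f \<in> restrict_fun E ` {u + w | u w. u \<in> polys (int r) \<and> w \<in> fun_span supplement_funs}"
    then show "f \<in> {restrict_fun E u + restrict_fun E w | u w.
        u \<in> polys (int r) \<and> w \<in> fun_span supplement_funs}"
      unfolding restrict_fun_plus[symmetric] by blast
  next
    fix f assume "f \<in> {restrict_fun E u + restrict_fun E w | u w.
        u \<in> polys (int r) \<and> w \<in> fun_span supplement_funs}"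
    then show "f \<in> restrict_fun E ` {u + w | u w. u \<in> polys (int r) \<and> w \<in> fun_span supplement_funs}"
      unfolding restrict_fun_plus[symmetric] by blast
  qed
  have supp_eq: "supplement_space E r l1 l2 l3 l4 lH lV RV RH = restrict_fun E ` fun_span supplement_funs"
    unfolding supplement_space_def span_restrict_image[symmetric] supplement_funs_def by simp
  show ?thesis
  proof
    show "\<forall>\<phi> \<in> DS E r l1 l2 l3 l4 lH lV l12 l34 RV RH. (\<forall>k\<in>{1..D}. \<phi> (xn k) = 0) \<longrightarrow> \<phi> = 0"
    proof (intro ballI impI)
      fix \<phi> assume "\<phi> \<in> DS E r l1 l2 l3 l4 lH lV l12 l34 RV RH" and z: "\<forall>k\<in>{1..D}. \<phi> (xn k) = 0"
      then obtain u w where u: "u \<in> polys (int r)" and w: "w \<in> fun_span supplement_funs"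
        and \<phi>: "\<phi> = restrict_fun E u + restrict_fun E w" unfolding DS_eq by blast
      have "u x + w x = 0" if "x \<in> ?nodes" for x
      proof -
        have "\<phi> x = 0" using nodes_X that z by blast
        moreover have "x \<in> E" using nodes_E that by blast
        ultimately show ?thesis by (simp add: \<phi> restrict_fun_def)
      qed
      then have "u = (\<lambda>x. 0) \<and> w = (\<lambda>x. 0)" by (rule uni[OF u w])
      then show "\<phi> = 0" by (simp add: \<phi> restrict_fun_zero plus_fun_def zero_fun_def)
    qed
    show "direct_sum_of (DS E r l1 l2 l3 l4 lH lV l12 l34 RV RH)
           (polys_on E (int r)) (supplement_space E r l1 l2 l3 l4 lH lV RV RH)"
      unfolding direct_sum_of_def
    proof (intro conjI)
      show s1: "fun_subspace (polys_on E (int r))"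
        unfolding polys_on_def by (rule subspace_restrict_image[OF subspace_polys])
      show s2: "fun_subspace (supplement_space E r l1 l2 l3 l4 lH lV RV RH)"
        unfolding supplement_space_def by (rule fun_space.subspace_span)
      show "DS E r l1 l2 l3 l4 lH lV l12 l34 RV RH = {u + v | u v. u \<in> polys_on E (int r) \<and>
          v \<in> supplement_space E r l1 l2 l3 l4 lH lV RV RH}"
        unfolding DS_eq polys_on_def supp_eq by blast
      have "f = 0" if f: "f \<in> polys_on E (int r)" "f \<in> supplement_space E r l1 l2 l3 l4 lH lV RV RH" for f
      proof -
        obtain u w where u: "u \<in> polys (int r)" "f = restrict_fun E u"
          and w: "w \<in> fun_span supplement_funs" "f = restrict_fun E w"
          using f unfolding polys_on_def supp_eq by blast
        \<comment> \<open>A function in the intersection gives a difference \<open>u - w\<close> that vanishes on \<open>E\<close>.\<close>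
        have "u x + (- 1) * w x = 0" if "x \<in> ?nodes" for x
        proof -
          have "x \<in> E" using nodes_E that by blast
          moreover have "restrict_fun E u x = restrict_fun E w x" using u w by simp
          ultimately show ?thesis by (simp add: restrict_fun_def)
        qed
        then have "u = (\<lambda>x. 0)" using uni[OF u(1) fun_span_scale[OF w(1), of "- 1"]] by blast
        then show "f = 0" by (simp add: u(2) restrict_fun_zero zero_fun_def)
      qed
      then show "polys_on E (int r) \<inter> supplement_space E r l1 l2 l3 l4 lH lV RV RH = {0}"
        using fun_space.subspace_0[OF s1] fun_space.subspace_0[OF s2] by auto
    qed
  qed
qed

end
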